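(* Let $0\to\mathfrak{n}\to\mathfrak{n}\rtimes_{\varphi}\mathfrak{h}\to\mathfrak{h}\to 0$ be a split extension of Lie algebras over a field $k$, with $\varphi:\mathfrak{h}\to\mathrm{Der}(\mathfrak{n})$ the corresponding Lie algebra homomorphism, such that $\varphi(\mathfrak{h})$ is one-dimensional. Then the Hochschild-Serre spectral sequence associated to this extension collapses at page two for all coefficients in $\mathfrak{h}\text{-mod}$.
   Context: $\mathfrak{n}\rtimes_\varphi\mathfrak{h}$ is the semi-direct product Lie algebra determined by $\varphi$. $\mathfrak{h}\text{-mod}$ denotes the $\mathfrak{h}$-modules, viewed as modules over $\mathfrak{g}=\mathfrak{n}\rtimes_\varphi\mathfrak{h}$ via the projection $\mathfrak{g}\to\mathfrak{h}$ (equivalently, the $\mathfrak{g}$-modules $M$ with $M^{\mathfrak{n}}=M$). The Hochschild-Serre spectral sequence with coefficients $M$ is $E_2^{p,q}(M)=\mathrm{H}^p(\mathfrak{h},\mathrm{H}^q(\mathfrak{n},M))\Rightarrow\mathrm{H}^{p+q}(\mathfrak{g},M)$. It collapses at page two if all differentials $d_r$ with $r\geq 2$ are zero. *)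

theory Defs
  imports
    Complex_Main
    "HOL-Library.Function_Algebras"
    "HOL-Library.Product_Plus"
    "HOL-Library.Set_Algebras"
begin

section \<open>Lie algebras and their modules\<close>

locale lie_algebra = vector_space scale
  for scale :: "'k::field \<Rightarrow> 'g::ab_group_add \<Rightarrow> 'g" +
  fixes bracket :: "'g \<Rightarrow> 'g \<Rightarrow> 'g"
  assumes linear_bracket_left: "Vector_Spaces.linear scale scale (\<lambda>x. bracket x y)"
    and linear_bracket_right: "Vector_Spaces.linear scale scale (bracket x)"
    and bracket_self: "bracket x x = 0"
    and jacobi: "bracket x (bracket y z) + bracket y (bracket z x) + bracket z (bracket x y) = 0"

locale lie_module = lie_algebra scale bracket + M: vector_space scaleM
  for scale :: "'k::field \<Rightarrow> 'g::ab_group_add \<Rightarrow> 'g"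
    and bracket :: "'g \<Rightarrow> 'g \<Rightarrow> 'g"
    and scaleM :: "'k \<Rightarrow> 'm::ab_group_add \<Rightarrow> 'm" +
  fixes act :: "'g \<Rightarrow> 'm \<Rightarrow> 'm"
  assumes linear_act_left: "Vector_Spaces.linear scale scaleM (\<lambda>x. act x m)"
    and linear_act_right: "Vector_Spaces.linear scaleM scaleM (act x)"
    and act_bracket: "act (bracket x y) m = act x (act y m) - act y (act x m)"


section \<open>Chevalley-Eilenberg cochains\<close>

definition omit :: "nat \<Rightarrow> 'a list \<Rightarrow> 'a list"
  where "omit i xs = take i xs @ drop (Suc i) xs"

context lie_module
begin

text \<open>
  An alternating \<open>n\<close>-multilinear map is represented by a function on lists of arguments, extended by
  zero to the lists of length different from \<open>n\<close> (so that multilinearity may be required for lists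
  of every length). Degrees are integers; for \<open>n < 0\<close> only the zero function is a cochain.
\<close>

definition cochains :: "int \<Rightarrow> ('g list \<Rightarrow> 'm) set"
  where "cochains n = {f.
    (\<forall>xs. int (length xs) \<noteq> n \<longrightarrow> f xs = 0) \<and>
    (\<forall>xs ys. Vector_Spaces.linear scale scaleM (\<lambda>x. f (xs @ x # ys))) \<and>
    (\<forall>xs. \<not> distinct xs \<longrightarrow> f xs = 0)}"

text \<open>
  The degree is read off from the length of the argument list: on an \<open>n\<close>-cochain the right-hand
  side vanishes for lists of length different from \<open>n + 1\<close>. The arguments are numbered from 0.
\<close>

definition coboundary :: "('g list \<Rightarrow> 'm) \<Rightarrow> 'g list \<Rightarrow> 'm"
  where "coboundary f xs =
    (\<Sum>i<length xs. scaleM ((- 1) ^ i) (act (xs ! i) (f (omit i xs)))) +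
    (\<Sum>j<length xs. \<Sum>i<j.
      scaleM ((- 1) ^ (i + j)) (f (bracket (xs ! i) (xs ! j) # omit i (omit j xs))))"

end


section \<open>The Hochschild-Serre spectral sequence of an ideal\<close>

locale hochschild_serre = lie_module scale bracket scaleM act
  for scale :: "'k::field \<Rightarrow> 'g::ab_group_add \<Rightarrow> 'g"
    and bracket :: "'g \<Rightarrow> 'g \<Rightarrow> 'g"
    and scaleM :: "'k \<Rightarrow> 'm::ab_group_add \<Rightarrow> 'm"
    and act :: "'g \<Rightarrow> 'm \<Rightarrow> 'm" +
  fixes I :: "'g set"
  assumes subspace_ideal: "subspace I"
    and bracket_ideal: "y \<in> I \<Longrightarrow> bracket x y \<in> I"
begin

text \<open>
  The filtration of Hochschild and Serre: the \<open>p\<close>-th step consists of the \<open>n\<close>-cochains that vanish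
  as soon as at least \<open>n - p + 1\<close> of the arguments lie in the ideal. This is everything for
  \<open>p \<le> 0\<close> and zero for \<open>p > n\<close>.
\<close>

definition filtration :: "int \<Rightarrow> int \<Rightarrow> ('g list \<Rightarrow> 'm) set"
  where "filtration p n = {f \<in> cochains n.
    \<forall>xs. int (card {i. i < length xs \<and> xs ! i \<in> I}) \<ge> n - p + 1 \<longrightarrow> f xs = 0}"

text \<open>
  The spectral sequence of the filtered cochain complex, with \<open>n = p + q\<close> the total degree:
  \<open>E r p q\<close> is the quotient of \<open>Z r p n\<close> by \<open>B r p n = Z (r - 1) (p + 1) n + d (Z (r - 1) (p - r + 1) (n - 1))\<close>,
  realised as the set of cosets. The differential sends the class of a cochain \<open>f\<close> to the class of
  its coboundary in \<open>E r (p + r) (q - r + 1)\<close>; on a coset this is written as a sum of sets.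
\<close>

definition Z :: "int \<Rightarrow> int \<Rightarrow> int \<Rightarrow> ('g list \<Rightarrow> 'm) set"
  where "Z r p n = {f \<in> filtration p n. coboundary f \<in> filtration (p + r) (n + 1)}"

definition B :: "int \<Rightarrow> int \<Rightarrow> int \<Rightarrow> ('g list \<Rightarrow> 'm) set"
  where "B r p n = Z (r - 1) (p + 1) n + coboundary ` Z (r - 1) (p - r + 1) (n - 1)"

definition E :: "int \<Rightarrow> int \<Rightarrow> int \<Rightarrow> ('g list \<Rightarrow> 'm) set set"
  where "E r p q = (\<lambda>f. f +o B r p (p + q)) ` Z r p (p + q)"

definition E_zero :: "int \<Rightarrow> int \<Rightarrow> int \<Rightarrow> ('g list \<Rightarrow> 'm) set"
  where "E_zero r p q = B r p (p + q)"

definition differential :: "int \<Rightarrow> int \<Rightarrow> int \<Rightarrow> ('g list \<Rightarrow> 'm) set \<Rightarrow> ('g list \<Rightarrow> 'm) set"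
  where "differential r p q X = coboundary ` X + B r (p + r) (p + q + 1)"

definition collapses_at_page :: "int \<Rightarrow> bool"
  where "collapses_at_page s \<longleftrightarrow>
    (\<forall>r\<ge>s. \<forall>p q. \<forall>X\<in>E r p q. differential r p q X = E_zero r (p + r) (q - r + 1))"

end


section \<open>Derivations and semi-direct products\<close>

abbreviation (input) scale_fun :: "('k \<Rightarrow> 'b \<Rightarrow> 'b) \<Rightarrow> 'k \<Rightarrow> ('a \<Rightarrow> 'b) \<Rightarrow> 'a \<Rightarrow> 'b"
  where "scale_fun scale c f \<equiv> (\<lambda>x. scale c (f x))"

lemma (in vector_space) vector_space_scale_fun:
  "vector_space (scale_fun scale :: _ \<Rightarrow> ('c \<Rightarrow> 'b) \<Rightarrow> _)"
  by unfold_locales (auto simp: fun_eq_iff scale_right_distrib scale_left_distrib)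

definition (in lie_algebra) Der :: "('g \<Rightarrow> 'g) set"
  where "Der = {D. Vector_Spaces.linear scale scale D \<and>
    (\<forall>x y. D (bracket x y) = bracket (D x) y + bracket x (D y))}"

locale lie_derivation_action =
  N: lie_algebra scaleN bracketN + H: lie_algebra scaleH bracketH
  for scaleN :: "'k::field \<Rightarrow> 'n::ab_group_add \<Rightarrow> 'n"
    and bracketN :: "'n \<Rightarrow> 'n \<Rightarrow> 'n"
    and scaleH :: "'k \<Rightarrow> 'h::ab_group_add \<Rightarrow> 'h"
    and bracketH :: "'h \<Rightarrow> 'h \<Rightarrow> 'h" +
  fixes \<phi> :: "'h \<Rightarrow> 'n \<Rightarrow> 'n"
  assumes derivation: "\<phi> x \<in> N.Der"
    and linear_hom: "Vector_Spaces.linear scaleH (scale_fun scaleN) \<phi>"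
    and hom_bracket: "\<phi> (bracketH x y) = (\<phi> x \<circ> \<phi> y) - (\<phi> y \<circ> \<phi> x)"

definition semidirect_scale ::
  "('k \<Rightarrow> 'n \<Rightarrow> 'n) \<Rightarrow> ('k \<Rightarrow> 'h \<Rightarrow> 'h) \<Rightarrow> 'k \<Rightarrow> 'n \<times> 'h \<Rightarrow> 'n \<times> 'h"
  where "semidirect_scale scaleN scaleH c x = (scaleN c (fst x), scaleH c (snd x))"

definition semidirect_bracket ::
  "('n::ab_group_add \<Rightarrow> 'n \<Rightarrow> 'n) \<Rightarrow> ('h \<Rightarrow> 'h \<Rightarrow> 'h) \<Rightarrow> ('h \<Rightarrow> 'n \<Rightarrow> 'n) \<Rightarrow>
    'n \<times> 'h \<Rightarrow> 'n \<times> 'h \<Rightarrow> 'n \<times> 'h"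
  where "semidirect_bracket bracketN bracketH \<phi> x y =
    (bracketN (fst x) (fst y) + \<phi> (snd x) (fst y) - \<phi> (snd y) (fst x),
     bracketH (snd x) (snd y))"

definition semidirect_ideal :: "('n \<times> 'h::zero) set"
  where "semidirect_ideal = UNIV \<times> {0}"

definition inflate :: "('h \<Rightarrow> 'm \<Rightarrow> 'm) \<Rightarrow> 'n \<times> 'h \<Rightarrow> 'm \<Rightarrow> 'm"
  where "inflate act x = act (snd x)"

context lie_derivation_action
begin

lemma lie_algebra_semidirect:
  "lie_algebra (semidirect_scale scaleN scaleH) (semidirect_bracket bracketN bracketH \<phi>)"
proof -
  have vs: "vector_space (semidirect_scale scaleN scaleH)"
    by unfold_locales
      (auto simp: semidirect_scale_def prod_eq_iff N.scale_right_distrib N.scale_left_distrib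
        H.scale_right_distrib H.scale_left_distrib)
  have linI: "Vector_Spaces.linear (semidirect_scale scaleN scaleH) (semidirect_scale scaleN scaleH) f"
    if "\<And>x y. f (x + y) = f x + f y"
      "\<And>c x. f (semidirect_scale scaleN scaleH c x) = semidirect_scale scaleN scaleH c (f x)" for f
    using that vs by (simp add: Vector_Spaces.linear_iff)
  note LN = N.linear_bracket_left[unfolded Vector_Spaces.linear_iff]
    N.linear_bracket_right[unfolded Vector_Spaces.linear_iff]
  note LH = H.linear_bracket_left[unfolded Vector_Spaces.linear_iff]
    H.linear_bracket_right[unfolded Vector_Spaces.linear_iff]
  have phi_add: "\<phi> (x + y) n = \<phi> x n + \<phi> y n"
    and phi_scale: "\<phi> (scaleH c x) n = scaleN c (\<phi> x n)" for x y n c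
    using linear_hom[unfolded Vector_Spaces.linear_iff] by (simp_all add: plus_fun_def)
  have D_add: "\<phi> x (m + n) = \<phi> x m + \<phi> x n"
    and D_scale: "\<phi> x (scaleN c n) = scaleN c (\<phi> x n)"
    and D_bracket: "\<phi> x (bracketN m n) = bracketN (\<phi> x m) n + bracketN m (\<phi> x n)" for x m n c
    using derivation[of x] by (simp_all add: N.Der_def Vector_Spaces.linear_iff)
  have D_diff: "\<phi> x (m - n) = \<phi> x m - \<phi> x n" for x m n
    using D_add[of x "m - n" n] by (simp add: algebra_simps)
  have phi_bracket: "\<phi> (bracketH x y) n = \<phi> x (\<phi> y n) - \<phi> y (\<phi> x n)" for x y n
    by (simp only: hom_bracket fun_diff_def o_apply)
  have NaddL: "bracketN (a + b) c = bracketN a c + bracketN b c"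
    and NaddR: "bracketN a (b + c) = bracketN a b + bracketN a c"
    and NscL: "bracketN (scaleN t a) b = scaleN t (bracketN a b)"
    and NscR: "bracketN a (scaleN t b) = scaleN t (bracketN a b)" for a b c t
    using LN by auto
  have HaddL: "bracketH (a + b) c = bracketH a c + bracketH b c"
    and HaddR: "bracketH a (b + c) = bracketH a b + bracketH a c"
    and HscL: "bracketH (scaleH t a) b = scaleH t (bracketH a b)"
    and HscR: "bracketH a (scaleH t b) = scaleH t (bracketH a b)" for a b c t
    using LH by auto
  have NdiffR: "bracketN a (b - c) = bracketN a b - bracketN a c" for a b c
    using NaddR[of a "b - c" c] by (simp add: algebra_simps)
  have Nanti: "bracketN a b = - bracketN b a" for a b
  proof -
    have "bracketN (a + b) (a + b) = bracketN a b + bracketN b a"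
      unfolding NaddL NaddR by (simp add: N.bracket_self)
    then show ?thesis
      using N.bracket_self[of "a + b"] by (simp add: eq_neg_iff_add_eq_0)
  qed
  show ?thesis
  proof (intro lie_algebra.intro vs lie_algebra_axioms.intro linI)
    fix x y z :: "'n \<times> 'h"
    have J: "bracketN a (bracketN b c) = - bracketN b (bracketN c a) - bracketN c (bracketN a b)" for a b c
      using N.jacobi[of a b c] by (simp add: algebra_simps eq_neg_iff_add_eq_0)
    obtain a1 b1 where x: "x = (a1, b1)" by (cases x)
    obtain a2 b2 where y: "y = (a2, b2)" by (cases y)
    obtain a3 b3 where z: "z = (a3, b3)" by (cases z)
    show "semidirect_bracket bracketN bracketH \<phi> x (semidirect_bracket bracketN bracketH \<phi> y z) +
      semidirect_bracket bracketN bracketH \<phi> y (semidirect_bracket bracketN bracketH \<phi> z x) +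
      semidirect_bracket bracketN bracketH \<phi> z (semidirect_bracket bracketN bracketH \<phi> x y) = 0"
      unfolding x y z
      by (simp add: semidirect_bracket_def prod_eq_iff H.jacobi phi_bracket NaddR NdiffR D_add D_diff
          D_bracket J[of a1 a2 a3] Nanti[of "\<phi> b1 a2" a3] Nanti[of "\<phi> b2 a3" a1] Nanti[of "\<phi> b3 a1" a2]
          Nanti[of "\<phi> b1 a3" a2] Nanti[of "\<phi> b2 a1" a3] Nanti[of "\<phi> b3 a2" a1])
  qed (simp_all add: semidirect_bracket_def semidirect_scale_def prod_eq_iff N.bracket_self
      H.bracket_self NaddL NaddR NscL NscR HaddL HaddR HscL HscR phi_add phi_scale D_add D_scale
      N.scale_right_distrib N.scale_right_diff_distrib)
qed

lemma hochschild_serre_semidirect: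
  assumes "lie_module scaleH bracketH scaleM act"
  shows "hochschild_serre (semidirect_scale scaleN scaleH) (semidirect_bracket bracketN bracketH \<phi>)
    scaleM (inflate act) semidirect_ideal"
proof -
  interpret M: lie_module scaleH bracketH scaleM act by fact
  interpret S: lie_algebra "semidirect_scale scaleN scaleH" "semidirect_bracket bracketN bracketH \<phi>"
    by (rule lie_algebra_semidirect)
  show ?thesis
  proof (intro hochschild_serre.intro hochschild_serre_axioms.intro lie_module.intro
      lie_module_axioms.intro S.lie_algebra_axioms M.M.vector_space_axioms)
    show "Vector_Spaces.linear (semidirect_scale scaleN scaleH) scaleM (\<lambda>x. inflate act x m)" for m
      using M.linear_act_left[of m] S.vector_space_axioms M.M.vector_space_axioms
      by (simp add: Vector_Spaces.linear_iff inflate_def semidirect_scale_def)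
    show "Vector_Spaces.linear scaleM scaleM (inflate act x)" for x
      by (simp add: inflate_def M.linear_act_right)
    show "inflate act (semidirect_bracket bracketN bracketH \<phi> x y) m =
        inflate act x (inflate act y m) - inflate act y (inflate act x m)" for x y m
      by (simp add: inflate_def semidirect_bracket_def M.act_bracket)
    show "S.subspace semidirect_ideal"
      by (auto simp: S.subspace_def semidirect_ideal_def semidirect_scale_def mem_Times_iff)
    show "semidirect_bracket bracketN bracketH \<phi> x y \<in> semidirect_ideal" if "y \<in> semidirect_ideal" for x y
      using that Modules.module_hom.zero[OF Vector_Spaces.linear.axioms(3)[OF H.linear_bracket_right], of "snd x"]
      by (auto simp: semidirect_bracket_def semidirect_ideal_def mem_Times_iff)
  qed
qed

end

end

theory Submission
  imports Defs
begin

text \<open>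
  Let \<open>\<phi>(\<hh>)\<close> be spanned by a derivation \<open>D\<close> of \<open>\<nn>\<close>, so that \<open>\<phi>(x) = lam(x) D\<close> with a linear form \<open>lam\<close> on
  \<open>\<hh>\<close> that vanishes on brackets. Since \<open>\<hh>\<close> is a subalgebra of the semi-direct product, the
  Chevalley-Eilenberg complex is a double complex: a cochain amounts to an \<open>\<hh>\<close>-cochain \<open>c\<close> with values in
  the alternating maps \<open>A\<close> from \<open>\<nn>\<close> to \<open>M\<close>, and in horizontal degree \<open>p\<close> the coboundary is \<open>d\<^sub>h c + (-1)\<^sup>p d c\<close>,
  where \<open>d\<close> is the differential of \<open>A\<close> (\<open>restrict_ce_differential\<close>, \<open>restrict_shuffle\<close>). The filtration is the
  one by \<open>p\<close> (\<open>filtration_iff_restrict\<close>). An element \<open>x\<close> of \<open>\<hh>\<close> acts on \<open>A\<close> through its action on \<open>M\<close> and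
  through \<open>lam(x) \<Theta>\<close>, with \<open>\<Theta>\<close> the Lie derivative of \<open>D\<close>.

  All differentials from page two on vanish if each cochain \<open>f\<close> of filtration degree \<open>p\<close> whose coboundary has
  filtration degree \<open>p + 2\<close> can be made a cocycle by subtracting a cochain of filtration degree \<open>p + 1\<close>
  (\<open>collapses_at_page_2I\<close>). In other words, every cocycle of \<open>\<hh>\<close> with values in the cohomology of \<open>\<nn>\<close> has
  to lift to a cocycle of the semi-direct product.

  Conceptually this holds because the chains of \<open>\<nn>\<close> are a complex of modules over the polynomial ring
  \<open>k[D]\<close>, which has global dimension one, and such a complex is quasi-isomorphic to its homology. The proof
  makes this explicit. There is an operator \<open>P\<close> on \<open>A\<close> with \<open>d P d = d\<close> that commutes with the endomorphisms
  of \<open>M\<close> (\<open>natural_splitting\<close>). Then \<open>S = 1 - d P\<close> kills coboundaries, and its commutator with \<open>\<Theta>\<close> is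
  \<open>d T\<close> for an operator \<open>T\<close> that kills coboundaries as well. If \<open>c\<close> represents a cocycle with values in the
  cohomology of \<open>\<nn>\<close>, then \<open>S c + (-1)\<^sup>p lam \<and> T c\<close> is a cocycle of the double complex: the only obstruction
  left is a multiple of \<open>lam \<and> lam = 0\<close> (\<open>corrected_cocycle\<close>). Its lowest component \<open>S c\<close> differs from \<open>c\<close> by
  the coboundary \<open>d P c\<close> (\<open>exists_correction\<close>).
\<close>

section \<open>Alternating maps as functions on lists\<close>

definition signed :: "nat \<Rightarrow> 'm::ab_group_add \<Rightarrow> 'm"
  where "signed n m = (if even n then m else - m)"

definition alternating_maps ::
  "('k::field \<Rightarrow> 'g::ab_group_add \<Rightarrow> 'g) \<Rightarrow> ('k \<Rightarrow> 'm::ab_group_add \<Rightarrow> 'm) \<Rightarrow> ('g list \<Rightarrow> 'm) set"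
  where "alternating_maps s t = {f.
    (\<forall>xs ys. Vector_Spaces.linear s t (\<lambda>x. f (xs @ x # ys))) \<and>
    (\<forall>xs. \<not> distinct xs \<longrightarrow> f xs = 0)}"

lemma signed_simps [simp]:
  "signed 0 m = m" "signed (Suc n) m = - signed n m" "signed n 0 = 0"
  "signed n (signed n m) = m" "signed n (- m) = - signed n m"
  by (auto simp: signed_def)

lemma signed_add: "signed n (a + b) = signed n a + signed n b"
  by (auto simp: signed_def)

lemma signed_eq_0_iff [simp]: "signed n a = 0 \<longleftrightarrow> a = 0"
  by (auto simp: signed_def)

lemma (in vector_space) scale_minus_one_power: "scale ((- 1) ^ n) a = signed n a"
  by (auto simp: signed_def minus_one_power_iff)

context vector_space_pair
begin

lemma alternatingD:
  assumes "f \<in> alternating_maps s1 s2"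
  shows alternating_add: "f (xs @ (x + y) # ys) = f (xs @ x # ys) + f (xs @ y # ys)"
    and alternating_scale: "f (xs @ s1 c x # ys) = s2 c (f (xs @ x # ys))"
    and alternating_not_distinct: "\<not> distinct zs \<Longrightarrow> f zs = 0"
  using assms by (auto simp: alternating_maps_def Vector_Spaces.linear_iff)

lemma alternating_zero_arg:
  assumes "f \<in> alternating_maps s1 s2"
  shows "f (xs @ 0 # ys) = 0"
  using alternating_add[OF assms, of xs 0 0 ys] by simp

lemma alternating_swap:
  assumes "f \<in> alternating_maps s1 s2"
  shows "f (xs @ x # y # ys) = - f (xs @ y # x # ys)"
proof -
  note add = alternating_add[OF assms]
  have "0 = f (xs @ (x + y) # (x + y) # ys)"
    using alternating_not_distinct[OF assms] by simp
  also have "\<dots> = f (xs @ x # (x + y) # ys) + f (xs @ y # (x + y) # ys)"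
    by (rule add)
  also have "\<dots> = f (xs @ x # x # ys) + f (xs @ x # y # ys) + (f (xs @ y # x # ys) + f (xs @ y # y # ys))"
    using add[of "xs @ [x]" x y ys] add[of "xs @ [y]" x y ys] by simp
  also have "\<dots> = f (xs @ x # y # ys) + f (xs @ y # x # ys)"
    using alternating_not_distinct[OF assms] by simp
  finally show ?thesis
    by (simp add: eq_neg_iff_add_eq_0)
qed

lemma alternating_move:
  assumes "f \<in> alternating_maps s1 s2"
  shows "f (xs @ y # zs @ ws) = signed (length zs) (f (xs @ zs @ y # ws))"
proof (induction zs arbitrary: xs)
  case (Cons z zs)
  show ?case
    using alternating_swap[OF assms, of xs y z "zs @ ws"] Cons.IH[of "xs @ [z]"] by simp
qed simp

text \<open>
  Repeated arguments can be brought next to each other by adjacent transpositions, each of which only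
  changes the sign; so for a multilinear map it suffices to look at adjacent repetitions.
\<close>

lemma alternatingI:
  assumes add: "\<And>xs x y ys. f (xs @ (x + y) # ys) = f (xs @ x # ys) + f (xs @ y # ys)"
    and scale: "\<And>xs c x ys. f (xs @ s1 c x # ys) = s2 c (f (xs @ x # ys))"
    and adjacent: "\<And>xs x ys. f (xs @ x # x # ys) = 0"
  shows "f \<in> alternating_maps s1 s2"
proof -
  have swap: "f (xs @ x # y # ys) = - f (xs @ y # x # ys)" for xs x y ys
  proof -
    have "0 = f (xs @ (x + y) # (x + y) # ys)"
      using adjacent by simp
    also have "\<dots> = f (xs @ x # (x + y) # ys) + f (xs @ y # (x + y) # ys)"
      by (rule add)
    also have "\<dots> = f (xs @ x # y # ys) + f (xs @ y # x # ys)"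
      using add[of "xs @ [x]" x y ys] add[of "xs @ [y]" x y ys] adjacent by simp
    finally show ?thesis
      by (simp add: eq_neg_iff_add_eq_0)
  qed
  have "f (xs @ y # ys @ y # zs) = 0" for xs y ys zs
  proof (induction ys arbitrary: xs)
    case Nil
    then show ?case using adjacent by simp
  next
    case (Cons b ys)
    show ?case
      using swap[of xs y b "ys @ y # zs"] Cons.IH[of "xs @ [b]"] by simp
  qed
  then have "f xs = 0" if "\<not> distinct xs" for xs
    using not_distinct_decomp[OF that] by auto
  moreover have "Vector_Spaces.linear s1 s2 (\<lambda>x. f (xs @ x # ys))" for xs ys
    by (simp add: Vector_Spaces.linear_iff add scale vs1.vector_space_axioms vs2.vector_space_axioms)
  ultimately show ?thesis
    by (auto simp: alternating_maps_def)
qed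

lemma alternating_contract:
  assumes "f \<in> alternating_maps s1 s2"
  shows "(\<lambda>ys. f (x # ys)) \<in> alternating_maps s1 s2"
proof (rule alternatingI)
  show "f (x # xs @ (a + b) # ys) = f (x # xs @ a # ys) + f (x # xs @ b # ys)" for xs a b ys
    using alternating_add[OF assms, of "x # xs"] by simp
  show "f (x # xs @ s1 c a # ys) = s2 c (f (x # xs @ a # ys))" for xs c a ys
    using alternating_scale[OF assms, of "x # xs"] by simp
  show "f (x # xs @ a # a # ys) = 0" for xs a ys
    by (rule alternating_not_distinct[OF assms]) simp
qed

lemma alternating_plus:
  assumes "f \<in> alternating_maps s1 s2" "g \<in> alternating_maps s1 s2"
  shows "(\<lambda>xs. f xs + g xs) \<in> alternating_maps s1 s2"
  by (rule alternatingI)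
    (simp_all add: assms[THEN alternating_add] assms[THEN alternating_scale]
      assms[THEN alternating_not_distinct] vs2.scale_right_distrib)

lemma alternating_minus:
  assumes "f \<in> alternating_maps s1 s2" "g \<in> alternating_maps s1 s2"
  shows "(\<lambda>xs. f xs - g xs) \<in> alternating_maps s1 s2"
  by (rule alternatingI)
    (simp_all add: assms[THEN alternating_add] assms[THEN alternating_scale]
      assms[THEN alternating_not_distinct] vs2.scale_right_diff_distrib)

lemma alternating_zero: "(\<lambda>xs. 0) \<in> alternating_maps s1 s2"
  by (rule alternatingI) simp_all

lemma alternating_comp:
  assumes "f \<in> alternating_maps s1 s2" "Vector_Spaces.linear s2 s2 \<alpha>"
  shows "(\<lambda>xs. \<alpha> (f xs)) \<in> alternating_maps s1 s2"
proof -
  interpret Vector_Spaces.linear s2 s2 \<alpha> by fact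
  show ?thesis
    by (rule alternatingI)
      (simp_all add: assms(1)[THEN alternating_add] assms(1)[THEN alternating_scale]
        assms(1)[THEN alternating_not_distinct] add scale zero)
qed

lemma alternating_truncate:
  assumes "f \<in> alternating_maps s1 s2"
  shows "(\<lambda>xs. if int (length xs) = n then f xs else 0) \<in> alternating_maps s1 s2"
  by (rule alternatingI)
    (simp_all add: assms[THEN alternating_add] assms[THEN alternating_scale]
        assms[THEN alternating_not_distinct])

lemma alternating_signed:
  "f \<in> alternating_maps s1 s2 \<Longrightarrow> (\<lambda>xs. signed n (f xs)) \<in> alternating_maps s1 s2"
  using alternating_minus[OF alternating_zero, of f] by (cases "even n") (simp_all add: signed_def)

end

section \<open>Cartan's calculus on lists\<close>

text \<open>
  An alternating map is a function on lists, so contraction with \<open>x\<close> is \<open>\<lambda>xs. f (x # xs)\<close>. The operators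
  of Cartan's calculus are therefore defined by recursion through their commutators with contractions.
  The derivation \<open>\<delta>\<close> of the arguments and the operator \<open>\<alpha>\<close> on the values are independent parameters,
  which covers the Lie derivative along an element of a Lie algebra, the action of \<open>\<hh>\<close> on the
  cochains of \<open>\<nn>\<close>, and the operator induced by a derivation alone (\<open>\<alpha> = 0\<close>).
\<close>

fun lie_derivative ::
  "('m \<Rightarrow> 'm) \<Rightarrow> ('g \<Rightarrow> 'g) \<Rightarrow> ('g list \<Rightarrow> 'm::ab_group_add) \<Rightarrow> 'g list \<Rightarrow> 'm" where
  "lie_derivative \<alpha> \<delta> f [] = \<alpha> (f [])"
| "lie_derivative \<alpha> \<delta> f (y # ys) = lie_derivative \<alpha> \<delta> (\<lambda>zs. f (y # zs)) ys - f (\<delta> y # ys)"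

text \<open>
  This is Cartan's formula: the contraction of \<open>df\<close> with \<open>x\<close> is the Lie derivative of \<open>f\<close> along \<open>x\<close>
  minus the differential of the contraction of \<open>f\<close>. Almost every identity below
  is an induction on the argument list along this equation.
\<close>

fun ce_differential ::
  "('g \<Rightarrow> 'm \<Rightarrow> 'm) \<Rightarrow> ('g \<Rightarrow> 'g \<Rightarrow> 'g) \<Rightarrow> ('g list \<Rightarrow> 'm::ab_group_add) \<Rightarrow> 'g list \<Rightarrow> 'm" where
  "ce_differential act br f [] = 0"
| "ce_differential act br f (x # xs) =
    lie_derivative (act x) (br x) f xs - ce_differential act br (\<lambda>ys. f (x # ys)) xs"

fun wedge :: "('k \<Rightarrow> 'm \<Rightarrow> 'm) \<Rightarrow> ('g \<Rightarrow> 'k) \<Rightarrow> ('g list \<Rightarrow> 'm::ab_group_add) \<Rightarrow> 'g list \<Rightarrow> 'm" where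
  "wedge s l f [] = 0"
| "wedge s l f (x # xs) = s (l x) (f xs) - wedge s l (\<lambda>ys. f (x # ys)) xs"

lemma lie_derivative_add:
  assumes "additive \<alpha>"
  shows "lie_derivative \<alpha> \<delta> (\<lambda>zs. f zs + g zs) xs = lie_derivative \<alpha> \<delta> f xs + lie_derivative \<alpha> \<delta> g xs"
  by (induction xs arbitrary: f g) (simp_all add: additive.add[OF assms])

lemma lie_derivative_diff:
  assumes "additive \<alpha>"
  shows "lie_derivative \<alpha> \<delta> (\<lambda>zs. f zs - g zs) xs = lie_derivative \<alpha> \<delta> f xs - lie_derivative \<alpha> \<delta> g xs"
  by (induction xs arbitrary: f g) (simp_all add: additive.diff[OF assms])

lemma ce_differential_add:
  assumes "\<And>x. additive (act x)"
  shows "ce_differential act br (\<lambda>zs. f zs + g zs) xs =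
    ce_differential act br f xs + ce_differential act br g xs"
  by (induction xs arbitrary: f g) (simp_all add: lie_derivative_add[OF assms])

lemma ce_differential_diff:
  assumes "\<And>x. additive (act x)"
  shows "ce_differential act br (\<lambda>zs. f zs - g zs) xs =
    ce_differential act br f xs - ce_differential act br g xs"
  by (induction xs arbitrary: f g) (simp_all add: lie_derivative_diff[OF assms])

lemma lie_derivative_comp:
  assumes "additive \<mu>" "\<And>m. \<mu> (\<alpha> m) = \<alpha>' (\<mu> m)"
  shows "lie_derivative \<alpha>' \<delta> (\<lambda>zs. \<mu> (f zs)) xs = \<mu> (lie_derivative \<alpha> \<delta> f xs)"
  by (induction xs arbitrary: f) (simp_all add: assms(2) additive.diff[OF assms(1)])

lemma ce_differential_comp:
  assumes "additive \<mu>" "\<And>x m. \<mu> (act x m) = act' x (\<mu> m)"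
  shows "ce_differential act' br (\<lambda>zs. \<mu> (f zs)) xs = \<mu> (ce_differential act br f xs)"
proof (induction xs arbitrary: f)
  case Nil
  then show ?case by (simp add: additive.zero[OF assms(1)])
next
  case (Cons x xs)
  have "lie_derivative (act' x) (br x) (\<lambda>zs. \<mu> (f zs)) xs = \<mu> (lie_derivative (act x) (br x) f xs)"
    by (rule lie_derivative_comp[OF assms(1)]) (rule assms(2))
  then show ?case
    by (simp only: ce_differential.simps additive.diff[OF assms(1)] Cons.IH)
qed

lemma lie_derivative_cong:
  assumes "\<And>ys. length ys = length xs \<Longrightarrow> f ys = g ys"
  shows "lie_derivative \<alpha> \<delta> f xs = lie_derivative \<alpha> \<delta> g xs"
  using assms
proof (induction xs arbitrary: f g)
  case Nil
  show ?case by (simp add: Nil[of "[]"])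
next
  case (Cons y ys)
  have "lie_derivative \<alpha> \<delta> (\<lambda>zs. f (y # zs)) ys = lie_derivative \<alpha> \<delta> (\<lambda>zs. g (y # zs)) ys"
    by (rule Cons.IH) (simp add: Cons.prems)
  moreover have "f (\<delta> y # ys) = g (\<delta> y # ys)"
    by (rule Cons.prems) simp
  ultimately show ?case by simp
qed

lemma ce_differential_cong:
  assumes "\<And>ys. Suc (length ys) = length xs \<Longrightarrow> f ys = g ys"
  shows "ce_differential act br f xs = ce_differential act br g xs"
  using assms
proof (induction xs arbitrary: f g)
  case (Cons x xs)
  have "ce_differential act br (\<lambda>zs. f (x # zs)) xs = ce_differential act br (\<lambda>zs. g (x # zs)) xs"
    by (rule Cons.IH) (simp add: Cons.prems)
  moreover have "lie_derivative (act x) (br x) f xs = lie_derivative (act x) (br x) g xs"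
    by (rule lie_derivative_cong) (simp add: Cons.prems)
  ultimately show ?case by simp
qed simp

context vector_space_pair
begin

lemma lie_derivative_commutator:
  assumes "additive \<alpha>" "additive \<beta>" "f \<in> alternating_maps s1 s2"
    and mod: "\<And>m. \<alpha> (\<beta> m) - \<beta> (\<alpha> m) = \<gamma> m"
    and alg: "\<And>y. \<delta> (\<epsilon> y) - \<epsilon> (\<delta> y) = \<zeta> y"
  shows "lie_derivative \<alpha> \<delta> (lie_derivative \<beta> \<epsilon> f) xs - lie_derivative \<beta> \<epsilon> (lie_derivative \<alpha> \<delta> f) xs =
    lie_derivative \<gamma> \<zeta> f xs"
  using assms(3)
proof (induction xs arbitrary: f)
  case Nil
  then show ?case by (simp add: mod)
next
  case (Cons y ys)
  have "f (\<delta> (\<epsilon> y) # ys) = f (\<zeta> y # ys) + f (\<epsilon> (\<delta> y) # ys)"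
    using alternating_add[OF Cons.prems, of "[]" "\<zeta> y" "\<epsilon> (\<delta> y)" ys] by (simp flip: alg)
  then show ?case
    using Cons.IH[OF alternating_contract[OF Cons.prems, of y]]
    by (simp add: lie_derivative_diff assms(1,2) algebra_simps)
qed

text \<open>
  The differential is built from the module and Lie algebra structures alone, so it commutes with
  every operator that is induced by a derivation of both.
\<close>

lemma ce_differential_lie_derivative:
  assumes "additive \<alpha>" "\<And>x. additive (act x)" "f \<in> alternating_maps s1 s2"
    and mod: "\<And>y m. \<alpha> (act y m) - act y (\<alpha> m) = act (\<delta> y) m"
    and alg: "\<And>y z. \<delta> (br y z) - br y (\<delta> z) = br (\<delta> y) z"
  shows "lie_derivative \<alpha> \<delta> (ce_differential act br f) xs =
    ce_differential act br (lie_derivative \<alpha> \<delta> f) xs"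
  using assms(3)
proof (induction xs arbitrary: f)
  case Nil
  then show ?case by (simp add: additive.zero[OF assms(1)])
next
  case (Cons y ys)
  have "lie_derivative \<alpha> \<delta> (lie_derivative (act y) (br y) f) ys -
      lie_derivative (act y) (br y) (lie_derivative \<alpha> \<delta> f) ys =
      lie_derivative (act (\<delta> y)) (br (\<delta> y)) f ys"
    by (rule lie_derivative_commutator) (use assms Cons.prems in auto)
  then show ?case
    using Cons.IH[OF alternating_contract[OF Cons.prems, of y]]
    by (simp add: lie_derivative_diff ce_differential_diff assms(1,2) algebra_simps)
qed

lemma lie_derivative_alternating:
  assumes "Vector_Spaces.linear s2 s2 \<alpha>" "Vector_Spaces.linear s1 s1 \<delta>" "f \<in> alternating_maps s1 s2"
  shows "lie_derivative \<alpha> \<delta> f \<in> alternating_maps s1 s2"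
proof (rule alternatingI)
  interpret a: Vector_Spaces.linear s2 s2 \<alpha> by fact
  interpret d: Vector_Spaces.linear s1 s1 \<delta> by fact
  have add: "additive \<alpha>"
    by unfold_locales (rule a.add)
  show "lie_derivative \<alpha> \<delta> f (xs @ (x + y) # ys) =
      lie_derivative \<alpha> \<delta> f (xs @ x # ys) + lie_derivative \<alpha> \<delta> f (xs @ y # ys)" for xs x y ys
    using assms(3)
  proof (induction xs arbitrary: f)
    case Nil
    note f_add = alternating_add[OF Nil, of "[]", simplified]
    show ?case by (simp add: f_add lie_derivative_add add d.add)
  next
    case (Cons z xs)
    then show ?case
      using Cons.IH[OF alternating_contract[OF Cons.prems, of z]]
        alternating_add[OF Cons.prems, of "\<delta> z # xs" x y ys] by simp
  qed
  show "lie_derivative \<alpha> \<delta> f (xs @ s1 c x # ys) = s2 c (lie_derivative \<alpha> \<delta> f (xs @ x # ys))" for xs c x ys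
    using assms(3)
  proof (induction xs arbitrary: f)
    case Nil
    note f_scale = alternating_scale[OF Nil, of "[]", simplified]
    have "lie_derivative \<alpha> \<delta> (\<lambda>zs. s2 c (f (x # zs))) ys = s2 c (lie_derivative \<alpha> \<delta> (\<lambda>zs. f (x # zs)) ys)"
      by (rule lie_derivative_comp[where \<mu> = "s2 c"]) (auto intro: additive.intro simp: vs2.scale_right_distrib a.scale)
    then show ?case by (simp add: f_scale d.scale vs2.scale_right_diff_distrib)
  next
    case (Cons z xs)
    then show ?case
      using Cons.IH[OF alternating_contract[OF Cons.prems, of z]]
        alternating_scale[OF Cons.prems, of "\<delta> z # xs" c x ys]
      by (simp add: vs2.scale_right_diff_distrib)
  qed
  have zero: "lie_derivative \<alpha> \<delta> (\<lambda>zs. 0) xs = 0" for xs :: "'b list"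
    by (induction xs) (auto simp: a.zero)
  show "lie_derivative \<alpha> \<delta> f (xs @ x # x # ys) = 0" for xs x ys
    using assms(3)
  proof (induction xs arbitrary: f)
    case Nil
    have "(\<lambda>zs. f (x # x # zs)) = (\<lambda>zs. 0)"
      using alternating_not_distinct[OF Nil] by auto
    then show ?case
      using alternating_swap[OF Nil, of "[]" x "\<delta> x" ys] zero by simp
  next
    case (Cons z xs)
    then show ?case
      using Cons.IH[OF alternating_contract[OF Cons.prems, of z]]
        alternating_not_distinct[OF Cons.prems] by simp
  qed
qed

end

lemma wedge_cong:
  assumes "\<And>ys. Suc (length ys) = length xs \<Longrightarrow> f ys = g ys"
  shows "wedge s l f xs = wedge s l g xs"
  using assms
proof (induction xs arbitrary: f g)
  case (Cons x xs)
  have "wedge s l (\<lambda>zs. f (x # zs)) xs = wedge s l (\<lambda>zs. g (x # zs)) xs"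
    by (rule Cons.IH) (simp add: Cons.prems)
  then show ?case by (simp add: Cons.prems)
qed simp

lemma (in vector_space) wedge_diff:
  "wedge scale l (\<lambda>ys. f ys - g ys) xs = wedge scale l f xs - wedge scale l g xs"
  by (induction xs arbitrary: f g) (simp_all add: scale_right_diff_distrib)

lemma (in vector_space) wedge_add:
  "wedge scale l (\<lambda>ys. f ys + g ys) xs = wedge scale l f xs + wedge scale l g xs"
  by (induction xs arbitrary: f g) (simp_all add: scale_right_distrib)

lemma (in vector_space) wedge_scale:
  "wedge scale l (\<lambda>ys. scale c (f ys)) xs = scale c (wedge scale l f xs)"
  by (induction xs arbitrary: f) (simp_all add: scale_right_diff_distrib mult.commute)

lemma (in vector_space) wedge_zero: "wedge scale l (\<lambda>ys. 0) xs = 0"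
  by (induction xs) simp_all

text \<open>
  This kills the last obstruction to lifting cocycles: if \<open>\<phi>(\<hh>)\<close> is one-dimensional, then all
  obstructions involve powers of a single one-form.
\<close>

lemma (in vector_space) wedge_wedge: "wedge scale l (wedge scale l f) xs = 0"
proof (induction xs arbitrary: f)
  case (Cons x xs)
  then show ?case
    by (simp add: wedge_diff wedge_scale)
qed simp

lemma (in vector_space_pair) wedge_alternating:
  assumes lam: "\<And>x y. lam (x + y) = lam x + lam y" "\<And>c x. lam (s1 c x) = c * lam x"
    and f: "f \<in> alternating_maps s1 s2"
  shows "wedge s2 lam f \<in> alternating_maps s1 s2"
proof (rule alternatingI)
  show "wedge s2 lam f (xs @ (x + y) # ys) = wedge s2 lam f (xs @ x # ys) + wedge s2 lam f (xs @ y # ys)"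
    for xs x y ys
    using f
  proof (induction xs arbitrary: f)
    case Nil
    note f_add = alternating_add[OF Nil, of "[]", simplified]
    show ?case by (simp add: f_add lam vs2.wedge_add vs2.scale_left_distrib)
  next
    case (Cons z xs)
    then show ?case
      using Cons.IH[OF alternating_contract[OF Cons.prems, of z]]
        alternating_add[OF Cons.prems, of xs x y ys] by (simp add: vs2.scale_right_distrib)
  qed
  show "wedge s2 lam f (xs @ s1 c x # ys) = s2 c (wedge s2 lam f (xs @ x # ys))" for xs c x ys
    using f
  proof (induction xs arbitrary: f)
    case Nil
    note f_scale = alternating_scale[OF Nil, of "[]", simplified]
    show ?case by (simp add: f_scale lam vs2.wedge_scale vs2.scale_right_diff_distrib)
  next
    case (Cons z xs)
    then show ?case
      using Cons.IH[OF alternating_contract[OF Cons.prems, of z]]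
        alternating_scale[OF Cons.prems, of xs c x ys]
      by (simp add: vs2.scale_right_diff_distrib mult.commute)
  qed
  show "wedge s2 lam f (xs @ x # x # ys) = 0" for xs x ys
    using f
  proof (induction xs arbitrary: f)
    case Nil
    have "(\<lambda>zs. f (x # x # zs)) = (\<lambda>zs. 0)"
      using alternating_not_distinct[OF Nil] by auto
    then show ?case by (simp add: vs2.wedge_zero)
  next
    case (Cons z xs)
    then show ?case
      using Cons.IH[OF alternating_contract[OF Cons.prems, of z]]
        alternating_not_distinct[OF Cons.prems] by simp
  qed
qed

section \<open>The Chevalley-Eilenberg complex\<close>

context lie_module
begin

sublocale vector_space_pair scale scaleM ..

lemma additive_act: "additive (act x)"
  by unfold_locales
    (rule Modules.module_hom.add[OF Vector_Spaces.linear.axioms(3)[OF linear_act_right]])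

lemma act_0: "act 0 m = 0" "act x 0 = 0"
  by (rule Modules.module_hom.zero[OF Vector_Spaces.linear.axioms(3)[OF linear_act_left]],
      rule additive.zero[OF additive_act])

lemma bracket_0 [simp]: "bracket 0 x = 0" "bracket x 0 = 0"
  by (rule Modules.module_hom.zero[OF Vector_Spaces.linear.axioms(3)[OF linear_bracket_left]],
      rule Modules.module_hom.zero[OF Vector_Spaces.linear.axioms(3)[OF linear_bracket_right]])

lemma bracket_anticommute: "bracket x y = - bracket y x"
proof -
  have "bracket (x + y) (x + y) = bracket x y + bracket y x"
    using linear_bracket_left[of "x + y"] linear_bracket_right[of x] linear_bracket_right[of y]
    by (simp add: Vector_Spaces.linear_iff bracket_self[of x] bracket_self[of y])
  then show ?thesis
    using bracket_self[of "x + y"] by (simp add: eq_neg_iff_add_eq_0)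
qed

lemma bracket_derivation: "bracket x (bracket y z) - bracket y (bracket x z) = bracket (bracket x y) z"
proof -
  have "bracket y (bracket z x) = - bracket y (bracket x z)"
    using linear_bracket_right[of y] bracket_anticommute[of z x]
    by (simp add: Modules.module_hom.neg[OF Vector_Spaces.linear.axioms(3)])
  then show ?thesis
    using jacobi[of x y z] bracket_anticommute[of z "bracket x y"]
    by (simp add: algebra_simps)
qed

lemma lie_derivative_add_direction:
  assumes "f \<in> alternating_maps scale scaleM"
  shows "lie_derivative (act (x + y)) (bracket (x + y)) f xs =
    lie_derivative (act x) (bracket x) f xs + lie_derivative (act y) (bracket y) f xs"
  using assms
proof (induction xs arbitrary: f)
  case Nil
  then show ?case using linear_act_left by (simp add: Vector_Spaces.linear_iff)
next
  case (Cons z zs)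
  then show ?case
    using Cons.IH[OF alternating_contract[OF Cons.prems, of z]] linear_bracket_left[of z]
      alternating_add[OF Cons.prems, of "[]" "bracket x z" "bracket y z" zs]
    by (simp add: Vector_Spaces.linear_iff)
qed

lemma lie_derivative_scale_direction:
  assumes "f \<in> alternating_maps scale scaleM"
  shows "lie_derivative (act (scale c x)) (bracket (scale c x)) f xs =
    scaleM c (lie_derivative (act x) (bracket x) f xs)"
  using assms
proof (induction xs arbitrary: f)
  case Nil
  then show ?case using linear_act_left by (simp add: Vector_Spaces.linear_iff)
next
  case (Cons z zs)
  then show ?case
    using Cons.IH[OF alternating_contract[OF Cons.prems, of z]] linear_bracket_left[of z]
      alternating_scale[OF Cons.prems, of "[]" c "bracket x z" zs]
    by (simp add: Vector_Spaces.linear_iff M.scale_right_diff_distrib)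
qed

lemma ce_differential_scale:
  "ce_differential act bracket (\<lambda>zs. scaleM c (f zs)) xs = scaleM c (ce_differential act bracket f xs)"
proof (rule ce_differential_comp[where \<mu> = "scaleM c"])
  show "additive (scaleM c)"
    by unfold_locales (rule M.scale_right_distrib)
  show "scaleM c (act x m) = act x (scaleM c m)" for x m
    by (rule Modules.module_hom.scale[OF Vector_Spaces.linear.axioms(3)[OF linear_act_right], symmetric])
qed

lemma ce_differential_zero: "ce_differential act bracket (\<lambda>zs. 0) xs = 0"
  using ce_differential_scale[where c = 0 and f = "\<lambda>_. 0" and xs = xs] by simp

lemma ce_differential_alternating:
  assumes "f \<in> alternating_maps scale scaleM"
  shows "ce_differential act bracket f \<in> alternating_maps scale scaleM"
proof (rule alternatingI)
  let ?d = "ce_differential act bracket"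
  have L_alt: "lie_derivative (act z) (bracket z) g \<in> alternating_maps scale scaleM"
    if "g \<in> alternating_maps scale scaleM" for g z
    by (rule lie_derivative_alternating[OF linear_act_right linear_bracket_right that])
  show "?d f (xs @ (x + y) # ys) = ?d f (xs @ x # ys) + ?d f (xs @ y # ys)" for xs x y ys
    using assms
  proof (induction xs arbitrary: f)
    case Nil
    note f_add = alternating_add[OF Nil, of "[]", simplified]
    show ?case
      by (simp add: f_add lie_derivative_add_direction[OF Nil] ce_differential_add[OF additive_act])
  next
    case (Cons z xs)
    then show ?case
      using Cons.IH[OF alternating_contract[OF Cons.prems, of z]]
        alternating_add[OF L_alt[OF Cons.prems, of z], of xs x y ys] by simp
  qed
  show "?d f (xs @ scale c x # ys) = scaleM c (?d f (xs @ x # ys))" for xs c x ys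
    using assms
  proof (induction xs arbitrary: f)
    case Nil
    note f_scale = alternating_scale[OF Nil, of "[]", simplified]
    show ?case
      by (simp add: f_scale lie_derivative_scale_direction[OF Nil] ce_differential_scale
          M.scale_right_diff_distrib)
  next
    case (Cons z xs)
    then show ?case
      using Cons.IH[OF alternating_contract[OF Cons.prems, of z]]
        alternating_scale[OF L_alt[OF Cons.prems, of z], of xs c x ys]
      by (simp add: M.scale_right_diff_distrib)
  qed
  show "?d f (xs @ x # x # ys) = 0" for xs x ys
    using assms
  proof (induction xs arbitrary: f)
    case Nil
    have "(\<lambda>zs. f (x # x # zs)) = (\<lambda>zs. 0)"
      using alternating_not_distinct[OF Nil] by auto
    then show ?case
      using alternating_zero_arg[OF Nil, of "[]"] by (simp add: bracket_self ce_differential_zero)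
  next
    case (Cons z xs)
    then show ?case
      using Cons.IH[OF alternating_contract[OF Cons.prems, of z]]
        alternating_not_distinct[OF L_alt[OF Cons.prems, of z], of "xs @ x # x # ys"] by simp
  qed
qed

text \<open>
  By Cartan's formula the contraction of \<open>ddf\<close> with \<open>x\<close> is \<open>L\<^sub>x df - d L\<^sub>x f + d d (f (x # _))\<close>. The first
  two terms cancel and the last one vanishes by induction.
\<close>

lemma ce_differential_squared:
  assumes "f \<in> alternating_maps scale scaleM"
  shows "ce_differential act bracket (ce_differential act bracket f) xs = 0"
  using assms
proof (induction xs arbitrary: f)
  case (Cons x xs)
  let ?d = "ce_differential act bracket" and ?L = "lie_derivative (act x) (bracket x)"
  have "?L (?d f) xs = ?d (?L f) xs"
    by (rule ce_differential_lie_derivative)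
      (use Cons.prems additive_act act_bracket bracket_derivation in auto)
  then show ?case
    using Cons.IH[OF alternating_contract[OF Cons.prems, of x]]
    by (simp add: ce_differential_diff[OF additive_act])
qed simp

lemma lie_derivative_eq_sum:
  "lie_derivative \<alpha> \<delta> (f :: 'g list \<Rightarrow> 'm) xs = \<alpha> (f xs) - (\<Sum>i<length xs. f (xs[i := \<delta> (xs ! i)]))"
proof (induction xs arbitrary: f)
  case (Cons y ys)
  then show ?case
    by (simp add: sum.lessThan_Suc_shift del: sum.lessThan_Suc)
qed simp

text \<open>
  The terms of the alternating sum in which the first argument \<open>x\<close> is omitted or bracketed add up to the
  Lie derivative along \<open>x\<close>; the remaining ones, in which \<open>x\<close> stays an argument, form the coboundary of
  the contraction with \<open>x\<close>. Alternation is used to put the brackets into their places.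
\<close>

lemma coboundary_eq_ce_differential:
  assumes "f \<in> alternating_maps scale scaleM"
  shows "coboundary f xs = ce_differential act bracket f xs"
  using assms
proof (induction xs arbitrary: f)
  case Nil
  then show ?case by (simp add: coboundary_def)
next
  case (Cons x xs)
  let ?n = "length xs" and ?g = "\<lambda>ys. f (x # ys)"
  have omit: "omit 0 (a # ys) = ys" "omit (Suc i) (a # ys) = a # omit i ys" for a ys i
    by (simp_all add: omit_def)
  have replace: "scaleM ((- 1) ^ j) (f (b # omit j xs)) = f (xs[j := b])" if "j < ?n" for b j
    using that alternating_move[OF Cons.prems, of "[]" b "take j xs" "drop (Suc j) xs"]
    by (simp add: omit_def upd_conv_take_nth_drop M.scale_minus_one_power)
  have swap: "f (b # x # ys) = - f (x # b # ys)" for b ys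
    using alternating_swap[OF Cons.prems, of "[]" b x ys] by simp
  have "coboundary f (x # xs) = act x (f xs) +
      (\<Sum>i<?n. scaleM ((- 1) ^ Suc i) (act (xs ! i) (f (x # omit i xs)))) +
      (\<Sum>j<?n. scaleM ((- 1) ^ Suc j) (f (bracket x (xs ! j) # omit j xs)) +
        (\<Sum>i<j. scaleM ((- 1) ^ (Suc i + Suc j)) (f (bracket (xs ! i) (xs ! j) # x # omit i (omit j xs)))))"
    by (simp add: coboundary_def sum.lessThan_Suc_shift omit del: sum.lessThan_Suc power_Suc)
  also have "\<dots> = act x (f xs) - (\<Sum>j<?n. f (xs[j := bracket x (xs ! j)])) - coboundary ?g xs"
    by (simp add: coboundary_def sum.distrib sum_negf sum_subtractf swap replace)
  also have "\<dots> = ce_differential act bracket f (x # xs)"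
    using Cons.IH[OF alternating_contract[OF Cons.prems, of x]] by (simp add: lie_derivative_eq_sum)
  finally show ?case .
qed

lemma cochains_iff:
  "f \<in> cochains n \<longleftrightarrow> f \<in> alternating_maps scale scaleM \<and> (\<forall>xs. int (length xs) \<noteq> n \<longrightarrow> f xs = 0)"
  by (auto simp: cochains_def alternating_maps_def)

lemma coboundary_add: "coboundary (f + g) = coboundary f + coboundary g"
  by (rule ext)
    (simp add: coboundary_def additive.add[OF additive_act] M.scale_right_distrib sum.distrib)

lemma coboundary_minus: "coboundary (- f) = - coboundary f"
  by (rule ext)
    (simp add: coboundary_def additive.minus[OF additive_act] sum_negf)

lemma coboundary_diff: "coboundary (f - g) = coboundary f - coboundary g"
  using coboundary_add[of f "- g"] by (simp add: coboundary_minus)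

lemma coboundary_squared:
  assumes "f \<in> alternating_maps scale scaleM"
  shows "coboundary (coboundary f) = 0"
proof -
  have "coboundary f = ce_differential act bracket f"
    using coboundary_eq_ce_differential[OF assms] by auto
  then show ?thesis
    using coboundary_eq_ce_differential[OF ce_differential_alternating[OF assms]]
      ce_differential_squared[OF assms] by auto
qed

lemma coboundary_cochain:
  assumes "f \<in> cochains n"
  shows "coboundary f \<in> cochains (n + 1)"
proof -
  have f: "f \<in> alternating_maps scale scaleM" and deg: "\<And>xs. int (length xs) \<noteq> n \<Longrightarrow> f xs = 0"
    using assms by (auto simp: cochains_iff)
  have "coboundary f = ce_differential act bracket f"
    using coboundary_eq_ce_differential[OF f] by auto
  moreover have "ce_differential act bracket f xs = 0" if "int (length xs) \<noteq> n + 1" for xs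
  proof -
    have "ce_differential act bracket f xs = ce_differential act bracket (\<lambda>_. 0) xs"
      using that by (intro ce_differential_cong deg) linarith
    then show ?thesis by (simp add: ce_differential_zero)
  qed
  ultimately show ?thesis
    using ce_differential_alternating[OF f] by (auto simp: cochains_iff)
qed

end

section \<open>A criterion for the collapse at page two\<close>

context hochschild_serre
begin

lemma filtration_add: "f \<in> filtration p n \<Longrightarrow> g \<in> filtration p n \<Longrightarrow> f + g \<in> filtration p n"
  using alternating_plus[of f g] by (auto simp: filtration_def cochains_iff plus_fun_def)

lemma filtration_diff: "f \<in> filtration p n \<Longrightarrow> g \<in> filtration p n \<Longrightarrow> f - g \<in> filtration p n"
  using alternating_minus[of f g] by (auto simp: filtration_def cochains_iff fun_diff_def)

lemma filtration_zero: "0 \<in> filtration p n"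
  using alternating_zero by (auto simp: filtration_def cochains_iff zero_fun_def)

lemma filtration_mono: "p \<le> p' \<Longrightarrow> filtration p' n \<subseteq> filtration p n"
  by (auto simp: filtration_def)

lemma Z_add: "f \<in> Z r p n \<Longrightarrow> g \<in> Z r p n \<Longrightarrow> f + g \<in> Z r p n"
  by (auto simp: Z_def filtration_add coboundary_add)

lemma Z_diff: "f \<in> Z r p n \<Longrightarrow> g \<in> Z r p n \<Longrightarrow> f - g \<in> Z r p n"
  by (auto simp: Z_def filtration_diff coboundary_diff)

lemma Z_zero: "0 \<in> Z r p n"
proof -
  have "coboundary 0 = 0"
    using coboundary_diff[of 0 0] by simp
  then show ?thesis by (simp add: Z_def filtration_zero)
qed

lemma B_iff:
  "f \<in> B r p n \<longleftrightarrow>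
    (\<exists>a \<in> Z (r - 1) (p + 1) n. \<exists>b \<in> Z (r - 1) (p - r + 1) (n - 1). f = a + coboundary b)"
  by (auto simp: B_def set_plus_def)

lemma B_add:
  assumes "f \<in> B r p n" "g \<in> B r p n"
  shows "f + g \<in> B r p n"
proof -
  obtain a b a' b' where "f = a + coboundary b" "g = a' + coboundary b'"
    and *: "a \<in> Z (r - 1) (p + 1) n" "b \<in> Z (r - 1) (p - r + 1) (n - 1)"
      "a' \<in> Z (r - 1) (p + 1) n" "b' \<in> Z (r - 1) (p - r + 1) (n - 1)"
    using assms unfolding B_iff by blast
  then have "f + g = (a + a') + coboundary (b + b')"
    by (simp add: coboundary_add algebra_simps)
  then show ?thesis
    unfolding B_iff using Z_add * by blast
qed

lemma B_diff:
  assumes "f \<in> B r p n" "g \<in> B r p n"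
  shows "f - g \<in> B r p n"
proof -
  obtain a b a' b' where "f = a + coboundary b" "g = a' + coboundary b'"
    and *: "a \<in> Z (r - 1) (p + 1) n" "b \<in> Z (r - 1) (p - r + 1) (n - 1)"
      "a' \<in> Z (r - 1) (p + 1) n" "b' \<in> Z (r - 1) (p - r + 1) (n - 1)"
    using assms unfolding B_iff by blast
  then have "f - g = (a - a') + coboundary (b - b')"
    by (simp add: coboundary_diff algebra_simps)
  then show ?thesis
    unfolding B_iff using Z_diff * by blast
qed

lemma B_zero: "0 \<in> B r p n"
  unfolding B_iff using Z_zero coboundary_diff[of 0 0]
  by (intro bexI[of _ 0]) auto

lemma coboundary_in_B: "f \<in> Z (r - 1) (p + 1) n \<Longrightarrow> coboundary f \<in> B r (p + r) (n + 1)"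
  unfolding B_iff by (intro bexI[of _ 0] bexI[of _ f]) (simp_all add: Z_zero)

text \<open>
  If \<open>df = dg\<close> with \<open>g\<close> one step deeper in the filtration, then \<open>df\<close> is one of the coboundaries that are
  divided out in the target of \<open>d\<^sub>r\<close>. The page \<open>r\<close> enters only through \<open>df\<close> being at least two steps
  deeper than \<open>f\<close>, so one condition serves all pages.
\<close>

lemma collapses_at_page_2I:
  assumes correct: "\<And>p n f. f \<in> filtration p n \<Longrightarrow> coboundary f \<in> filtration (p + 2) (n + 1) \<Longrightarrow>
    \<exists>g \<in> filtration (p + 1) n. coboundary g = coboundary f"
  shows "collapses_at_page 2"
  unfolding collapses_at_page_def
proof (intro allI impI ballI)
  fix r p q :: int and X
  assume r: "2 \<le> r" and "X \<in> E r p q"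
  then obtain f where f: "f \<in> Z r p (p + q)" and X: "X = f +o B r p (p + q)"
    by (auto simp: E_def)
  define n where "n = p + q"
  let ?B = "B r (p + r) (n + 1)"
  obtain g where g: "g \<in> filtration (p + 1) n" "coboundary g = coboundary f"
    using correct[of f p n] f r filtration_mono[of "p + 2" "p + r" "n + 1"] by (auto simp: Z_def n_def)
  have "g \<in> Z (r - 1) (p + 1) n"
    using g f by (simp add: Z_def n_def)
  then have df: "coboundary f \<in> ?B"
    using coboundary_in_B g(2) by metis
  have "coboundary x \<in> ?B" if "x \<in> X" for x
  proof -
    obtain y where "x = f + y" "y \<in> B r p n"
      using \<open>x \<in> X\<close> unfolding X elt_set_plus_def n_def by blast
    then obtain a b where x: "x = f + (a + coboundary b)" and a: "a \<in> Z (r - 1) (p + 1) n"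
      and b: "b \<in> Z (r - 1) (p - r + 1) (n - 1)"
      unfolding B_iff by blast
    have "b \<in> alternating_maps scale scaleM"
      using b by (simp add: Z_def filtration_def cochains_iff)
    then have "coboundary x = coboundary f + coboundary a"
      by (simp add: x coboundary_add coboundary_squared)
    then show ?thesis
      using B_add[OF df coboundary_in_B[OF a]] by simp
  qed
  moreover have "f \<in> X"
    using B_zero unfolding X elt_set_plus_def by force
  ultimately have "coboundary ` X + ?B = ?B"
  proof (intro equalityI subsetI)
    fix h assume "h \<in> ?B"
    then have "coboundary f + (h - coboundary f) \<in> coboundary ` X + ?B"
      using \<open>f \<in> X\<close> B_diff df by (intro set_plus_intro) auto
    then show "h \<in> coboundary ` X + ?B" by simp
  qed (auto elim!: set_plus_elim intro: B_add)
  then show "differential r p q X = E_zero r (p + r) (q - r + 1)"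
    by (simp add: differential_def E_zero_def n_def algebra_simps)
qed

end

section \<open>Lifting a cocycle with values in cohomology\<close>

text \<open>
  This is the algebra behind the collapse, freed from multilinear maps. In the application \<open>A\<close>
  consists of the alternating maps on \<open>\<nn>\<close> with values in \<open>M\<close>, \<open>d\<close> is their Chevalley-Eilenberg
  differential, \<open>act0\<close> is the action of \<open>\<hh>\<close> on \<open>M\<close>, and \<open>\<Theta>\<close> is induced by the derivation that spans
  \<open>\<phi>(\<hh>)\<close>. The operator \<open>P\<close> splits the complex \<open>A\<close> compatibly with the action on \<open>M\<close>. Compatibility
  with \<open>\<Theta>\<close> would split \<open>A\<close> as a complex of \<open>\<hh>\<close>-modules, which is impossible in general; the point
  is to repair its failure.
\<close>

locale twisted_contraction = vector_space sc
  for sc :: "'k::field \<Rightarrow> 'l::ab_group_add \<Rightarrow> 'l" +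
  fixes A :: "'l set"
    and act0 :: "'h \<Rightarrow> 'l \<Rightarrow> 'l"
    and lam :: "'h \<Rightarrow> 'k"
    and br :: "'h \<Rightarrow> 'h \<Rightarrow> 'h"
    and \<Theta> d P :: "'l \<Rightarrow> 'l"
  assumes A: "subspace A"
    and act0: "a \<in> A \<Longrightarrow> act0 x a \<in> A"
      "act0 x (a + b) = act0 x a + act0 x b" "act0 x (sc t a) = sc t (act0 x a)"
    and \<Theta>: "a \<in> A \<Longrightarrow> \<Theta> a \<in> A"
      "\<Theta> (a + b) = \<Theta> a + \<Theta> b" "\<Theta> (sc t a) = sc t (\<Theta> a)" "\<Theta> (act0 x a) = act0 x (\<Theta> a)"
    and d: "a \<in> A \<Longrightarrow> d a \<in> A"
      "d (a + b) = d a + d b" "d (sc t a) = sc t (d a)" "d (act0 x a) = act0 x (d a)"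
    and P: "a \<in> A \<Longrightarrow> P a \<in> A"
      "a \<in> A \<Longrightarrow> b \<in> A \<Longrightarrow> P (a + b) = P a + P b" "a \<in> A \<Longrightarrow> P (sc t a) = sc t (P a)"
      "a \<in> A \<Longrightarrow> P (act0 x a) = act0 x (P a)"
    and lam_br: "lam (br x y) = 0"
    and dd: "a \<in> A \<Longrightarrow> d (d a) = 0"
    and \<Theta>d: "a \<in> A \<Longrightarrow> \<Theta> (d a) = d (\<Theta> a)"
    and dPd: "a \<in> A \<Longrightarrow> d (P (d a)) = d a"
begin

definition natural_operator :: "('l \<Rightarrow> 'l) \<Rightarrow> bool"
  where "natural_operator R \<longleftrightarrow> (\<forall>a\<in>A. R a \<in> A) \<and> (\<forall>a\<in>A. \<forall>b\<in>A. R (a + b) = R a + R b) \<and>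
    (\<forall>t. \<forall>a\<in>A. R (sc t a) = sc t (R a)) \<and> (\<forall>x. \<forall>a\<in>A. R (act0 x a) = act0 x (R a))"

text \<open>
  The action of \<open>\<hh>\<close> on \<open>A\<close>: the operator \<open>\<Theta>\<close> twists the action on the values by the linear form \<open>lam\<close>.
\<close>

definition vact :: "'h \<Rightarrow> 'l \<Rightarrow> 'l"
  where "vact x a = act0 x a + sc (lam x) (\<Theta> a)"

text \<open>
  The operator \<open>S\<close> annihilates coboundaries and changes every element by a coboundary only. So \<open>S\<close> of a
  cocycle is a representative of its class that depends on the class only.
\<close>

definition S :: "'l \<Rightarrow> 'l"
  where "S a = a - d (P a)"

text \<open>
  The commutator of \<open>\<Theta>\<close> and \<open>S\<close> takes values in the coboundaries, and \<open>P\<close> selects preimages of them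
  under \<open>d\<close> (\<open>d_T\<close>). Like the commutator, \<open>T\<close> annihilates coboundaries (\<open>T_coboundary\<close>).
\<close>

definition T :: "'l \<Rightarrow> 'l"
  where "T a = P (\<Theta> (S a) - S (\<Theta> a))"

lemmas A_closed = subspace_add[OF A] subspace_diff[OF A] subspace_scale[OF A] subspace_0[OF A]

lemma natural_operatorD:
  assumes "natural_operator R"
  shows "a \<in> A \<Longrightarrow> R a \<in> A" "a \<in> A \<Longrightarrow> b \<in> A \<Longrightarrow> R (a + b) = R a + R b"
    "a \<in> A \<Longrightarrow> R (sc t a) = sc t (R a)" "a \<in> A \<Longrightarrow> R (act0 x a) = act0 x (R a)"
    "R 0 = 0" "a \<in> A \<Longrightarrow> b \<in> A \<Longrightarrow> R (a - b) = R a - R b"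
proof -
  have *: "a \<in> A \<Longrightarrow> R a \<in> A" "a \<in> A \<Longrightarrow> b \<in> A \<Longrightarrow> R (a + b) = R a + R b"
    "a \<in> A \<Longrightarrow> R (sc t a) = sc t (R a)" "a \<in> A \<Longrightarrow> R (act0 x a) = act0 x (R a)" for a b t x
    using assms unfolding natural_operator_def by blast+
  then show "a \<in> A \<Longrightarrow> R a \<in> A" "a \<in> A \<Longrightarrow> b \<in> A \<Longrightarrow> R (a + b) = R a + R b"
    "a \<in> A \<Longrightarrow> R (sc t a) = sc t (R a)" "a \<in> A \<Longrightarrow> R (act0 x a) = act0 x (R a)"
    by blast+
  show "R 0 = 0"
    using *(2)[of 0 0] A_closed by simp
  show "a \<in> A \<Longrightarrow> b \<in> A \<Longrightarrow> R (a - b) = R a - R b"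
    using *(2)[of "a - b" b] A_closed by (simp add: algebra_simps)
qed

lemma natural_operators: "natural_operator \<Theta>" "natural_operator d" "natural_operator P"
  unfolding natural_operator_def using \<Theta> d P by auto

lemma natural_comp:
  assumes "natural_operator R" "natural_operator Q"
  shows "natural_operator (\<lambda>a. R (Q a))"
  unfolding natural_operator_def
  by (auto simp: natural_operatorD[OF assms(1)] natural_operatorD[OF assms(2)])

lemma act0_diff: "act0 x (a - b) = act0 x a - act0 x b"
  using act0(2)[of x "a - b" b] by (simp add: algebra_simps)

lemma natural_diff:
  assumes "natural_operator R" "natural_operator Q"
  shows "natural_operator (\<lambda>a. R a - Q a)"
  unfolding natural_operator_def
  by (auto simp: natural_operatorD[OF assms(1)] natural_operatorD[OF assms(2)] A_closed
      scale_right_diff_distrib act0_diff)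

lemma natural_id: "natural_operator (\<lambda>a. a)"
  by (simp add: natural_operator_def)

lemma natural_S: "natural_operator S"
  unfolding S_def[abs_def]
  by (rule natural_diff[OF natural_id natural_comp[OF natural_operators(2,3)]])

lemma natural_T: "natural_operator T"
  unfolding T_def[abs_def]
  by (rule natural_comp[OF natural_operators(3) natural_diff[OF natural_comp[OF natural_operators(1) natural_S]
          natural_comp[OF natural_S natural_operators(1)]]])

lemma vact_closed: "a \<in> A \<Longrightarrow> vact x a \<in> A"
  by (simp add: vact_def A_closed act0 \<Theta>)

lemma additive_vact: "additive (vact x)"
  by unfold_locales (simp add: vact_def act0 \<Theta> scale_right_distrib algebra_simps)

lemma vact_scale: "vact x (sc t a) = sc t (vact x a)"
  by (simp add: vact_def act0 \<Theta> scale_right_distrib mult.commute)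

lemma lie_derivative_closed:
  assumes "\<And>ys. c ys \<in> A"
  shows "lie_derivative (vact x) \<delta> c xs \<in> A"
  using assms by (induction xs arbitrary: c) (simp_all add: vact_closed A_closed)

lemma ce_differential_closed:
  assumes "\<And>ys. c ys \<in> A"
  shows "ce_differential vact \<delta> c xs \<in> A"
  using assms by (induction xs arbitrary: c) (simp_all add: lie_derivative_closed A_closed)

lemma wedge_closed:
  assumes "\<And>ys. c ys \<in> A"
  shows "wedge sc lam c xs \<in> A"
  using assms by (induction xs arbitrary: c) (simp_all add: A_closed)

lemma wedge_natural:
  assumes "natural_operator R" "\<And>ys. c ys \<in> A"
  shows "wedge sc lam (\<lambda>ys. R (c ys)) xs = R (wedge sc lam c xs)"
  using assms(2)
  by (induction xs arbitrary: c)
    (simp_all add: natural_operatorD[OF assms(1)] wedge_closed A_closed)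

lemma lie_derivative_natural:
  assumes "natural_operator R" "\<And>ys. c ys \<in> A"
  shows "lie_derivative (vact x) \<delta> (\<lambda>ys. R (c ys)) xs =
    R (lie_derivative (vact x) \<delta> c xs) + sc (lam x) (\<Theta> (R (c xs)) - R (\<Theta> (c xs)))"
  using assms(2)
proof (induction xs arbitrary: c)
  case Nil
  then show ?case
    by (simp add: vact_def natural_operatorD[OF assms(1)] act0 \<Theta> A_closed algebra_simps)
next
  case (Cons y ys)
  then show ?case
    by (simp add: natural_operatorD[OF assms(1)] lie_derivative_closed)
qed

text \<open>
  An operator that commutes with the untwisted action fails to be a map of \<open>\<hh>\<close>-modules only by its
  commutator with \<open>\<Theta>\<close>, weighted with the one-form \<open>lam\<close>.
\<close>

lemma ce_differential_natural:
  assumes "natural_operator R" "\<And>ys. c ys \<in> A"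
  shows "ce_differential vact br (\<lambda>ys. R (c ys)) xs = R (ce_differential vact br c xs) +
      wedge sc lam (\<lambda>ys. \<Theta> (R (c ys)) - R (\<Theta> (c ys))) xs"
  using assms(2)
proof (induction xs arbitrary: c)
  case Nil
  then show ?case using natural_operatorD(5)[OF assms(1)] A_closed by auto
next
  case (Cons y ys)
  then show ?case
    by (simp add: natural_operatorD[OF assms(1)] lie_derivative_closed ce_differential_closed
        lie_derivative_natural[OF assms(1)])
qed

lemma lie_derivative_wedge:
  "lie_derivative (vact x) (br x) (wedge sc lam c) ys = wedge sc lam (lie_derivative (vact x) (br x) c) ys"
proof (induction ys arbitrary: c)
  case Nil
  then show ?case by (simp add: additive.zero[OF additive_vact])
next
  case (Cons y ys)
  have "lie_derivative (vact x) (br x) (\<lambda>zs. sc (lam y) (c zs)) ys =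
      sc (lam y) (lie_derivative (vact x) (br x) c ys)"
    by (rule lie_derivative_comp[where \<mu> = "sc (lam y)"])
      (auto intro: additive.intro simp: scale_right_distrib vact_scale)
  then show ?case
    by (simp add: lie_derivative_diff[OF additive_vact] wedge_diff Cons.IH lam_br)
qed

text \<open>
  The form \<open>lam\<close> vanishes on brackets and is thus a cocycle, so that only the second term of the Leibniz
  rule is left.
\<close>

lemma ce_differential_wedge:
  "ce_differential vact br (wedge sc lam c) xs = - wedge sc lam (ce_differential vact br c) xs"
proof (induction xs arbitrary: c)
  case (Cons x xs)
  have "ce_differential vact br (\<lambda>zs. sc (lam x) (c zs)) xs =
      sc (lam x) (ce_differential vact br c xs)"
    by (rule ce_differential_comp[where \<mu> = "sc (lam x)"])
      (auto intro: additive.intro simp: scale_right_distrib vact_scale)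
  then show ?case
    by (simp add: ce_differential_diff[OF additive_vact] wedge_diff Cons.IH lie_derivative_wedge)
qed simp

lemma S_coboundary: "a \<in> A \<Longrightarrow> S (d a) = 0"
  by (simp add: S_def dPd)

lemma d_S: "a \<in> A \<Longrightarrow> d (S a) = d a"
  using natural_operatorD(6)[OF natural_operators(2)] by (simp add: S_def d P dd)

lemma T_coboundary: "a \<in> A \<Longrightarrow> T (d a) = 0"
  by (simp add: T_def S_coboundary \<Theta>d \<Theta> d natural_operatorD(5)[OF natural_operators(1)]
      natural_operatorD(5)[OF natural_operators(3)] A_closed)

text \<open>
  Put \<open>w = P \<Theta> a - \<Theta> P a\<close>. Since \<open>\<Theta>\<close> commutes with \<open>d\<close>, the commutator of \<open>\<Theta>\<close> with \<open>S = 1 - d P\<close> is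
  \<open>d w\<close>, and \<open>T a = P (d w)\<close>; the claim is \<open>d P d w = d w\<close>.
\<close>

lemma d_T:
  assumes "a \<in> A"
  shows "d (T a) = \<Theta> (S a) - S (\<Theta> a)"
proof -
  note diff = natural_operators[THEN natural_operatorD(6)]
  have "\<Theta> (S a) - S (\<Theta> a) = d (P (\<Theta> a) - \<Theta> (P a))"
    using assms by (simp add: S_def diff \<Theta>(1) d(1) P(1) \<Theta>d)
  then show ?thesis
    unfolding T_def using assms by (simp add: dPd \<Theta>(1) P(1) A_closed)
qed

text \<open>
  The two hypotheses \<open>vertical\<close> and \<open>horizontal\<close> say that \<open>c\<close> represents a cocycle of \<open>\<hh>\<close> with values in the
  cohomology of \<open>A\<close>. The horizontal differential of \<open>S c\<close> is \<open>lam \<and> (\<Theta> S - S \<Theta>) c\<close>, because \<open>S\<close> kills the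
  coboundaries \<open>d e\<close>; this equals \<open>d (lam \<and> T c)\<close>, so that the second summand of \<open>c'\<close> compensates it.
  Nothing further has to be corrected: the horizontal differential of \<open>T c\<close> is itself a multiple of
  \<open>lam\<close>, and multiplying it by \<open>lam\<close> again gives zero.
\<close>

lemma corrected_cocycle:
  fixes c :: "'h list \<Rightarrow> 'l" and p :: int
  defines "c' \<equiv> (\<lambda>xs. S (c xs) + signed (nat p) (wedge sc lam (\<lambda>ys. T (c ys)) xs))"
  assumes c: "\<And>xs. c xs \<in> A" and deg: "\<And>xs. int (length xs) \<noteq> p \<Longrightarrow> c xs = 0"
    and vertical: "\<And>xs. d (c xs) = 0"
    and horizontal: "\<And>xs. \<exists>e\<in>A. ce_differential vact br c xs = d e"
  shows "ce_differential vact br c' xs + signed (length xs) (d (c' xs)) = 0"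
proof -
  let ?D = "ce_differential vact br" and ?w = "wedge sc lam"
  let ?v = "\<lambda>ys. \<Theta> (S (c ys)) - S (\<Theta> (c ys))"
  have S: "?D (\<lambda>ys. S (c ys)) xs = ?w ?v xs"
    using horizontal[of xs] ce_differential_natural[OF natural_S c]
    by (auto simp: S_coboundary)
  have T: "?D (\<lambda>ys. T (c ys)) xs = ?w (\<lambda>ys. \<Theta> (T (c ys)) - T (\<Theta> (c ys))) xs" for xs
    using horizontal[of xs] ce_differential_natural[OF natural_T c]
    by (auto simp: T_coboundary)
  have "?D (?w (\<lambda>ys. T (c ys))) xs = 0"
    unfolding ce_differential_wedge T wedge_wedge by simp
  then have D: "?D c' xs = ?w ?v xs"
    using S unfolding c'_def
    by (cases "even (nat p)")
      (simp_all add: signed_def ce_differential_add[OF additive_vact] ce_differential_diff[OF additive_vact])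
  have neg: "d (- a) = - d a" for a
    using d(3)[of "-1" a] by simp
  have "d (?w (\<lambda>ys. T (c ys)) xs) = ?w (\<lambda>ys. d (T (c ys))) xs"
    using wedge_natural[OF natural_operators(2)] natural_operatorD(1)[OF natural_T] c by simp
  also have "\<dots> = ?w ?v xs"
    by (simp add: d_T c)
  finally have "d (c' xs) = signed (nat p) (?w ?v xs)"
    using c by (simp add: c'_def d(2) d_S vertical neg signed_def)
  \<comment> \<open>The form \<open>?w ?v\<close> lives in horizontal degree \<open>p + 1\<close>, where the two signs differ.\<close>
  moreover have "signed (length xs) (signed (nat p) (?w ?v xs)) = - ?w ?v xs"
  proof (cases "length xs = Suc (nat p)")
    case False
    have "S 0 = 0" "\<Theta> 0 = 0"
      using natural_operatorD(5) natural_S natural_operators A_closed by blast+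
    then have "?w ?v xs = ?w (\<lambda>_. 0) xs"
      using False by (intro wedge_cong) (auto simp: deg)
    then show ?thesis by (simp add: wedge_zero)
  qed simp
  ultimately show ?thesis
    by (simp add: D)
qed

end

section \<open>Natural splitting of the cochains with trivial coefficients\<close>

locale trivial_coefficients = lie_algebra scale bracket + M: vector_space scaleM
  for scale :: "'k::field \<Rightarrow> 'g::ab_group_add \<Rightarrow> 'g"
    and bracket :: "'g \<Rightarrow> 'g \<Rightarrow> 'g"
    and scaleM :: "'k \<Rightarrow> 'm::ab_group_add \<Rightarrow> 'm"
begin

sublocale lie_module scale bracket scaleM "\<lambda>_ _. 0"
  by unfold_locales (simp_all add: Vector_Spaces.linear_iff vector_space_axioms M.vector_space_axioms)

abbreviation "d \<equiv> ce_differential (\<lambda>_ _. 0 :: 'm) bracket"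

text \<open>
  Over a field every linear map has a generalised inverse, but an arbitrary one on the space of
  alternating maps would not be compatible with the endomorphisms of \<open>M\<close>. So the choice is made on the
  chain side. The evaluations \<open>ev xs\<close> of alternating \<open>M\<close>-valued maps satisfy the relations of the
  exterior algebra, and their span \<open>V\<close> serves as its substitute: every alternating map is a linear
  function on \<open>V\<close> by construction. The boundary operator \<open>bd\<close> dual to \<open>d\<close> preserves \<open>V\<close>, and
  precomposition with a generalised inverse \<open>\<rho>\<close> of \<open>bd\<close> on \<open>V\<close> is the operator \<open>P\<close>. It commutes with
  the endomorphisms of \<open>M\<close>, since these are applied after the evaluation.
\<close>

lemma natural_splitting:
  obtains P :: "('g list \<Rightarrow> 'm) \<Rightarrow> 'g list \<Rightarrow> 'm" where
    "\<And>f. f \<in> alternating_maps scale scaleM \<Longrightarrow> P f \<in> alternating_maps scale scaleM"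
    "\<And>f g. f \<in> alternating_maps scale scaleM \<Longrightarrow> g \<in> alternating_maps scale scaleM \<Longrightarrow>
      P (\<lambda>xs. f xs + g xs) = (\<lambda>xs. P f xs + P g xs)"
    "\<And>\<alpha> f. Vector_Spaces.linear scaleM scaleM \<alpha> \<Longrightarrow> f \<in> alternating_maps scale scaleM \<Longrightarrow>
      P (\<lambda>xs. \<alpha> (f xs)) = (\<lambda>xs. \<alpha> (P f xs))"
    "\<And>f. f \<in> alternating_maps scale scaleM \<Longrightarrow> d (P (d f)) = d f"
proof -
  let ?A = "alternating_maps scale scaleM"
  let ?sW = "\<lambda>c (v :: ('g list \<Rightarrow> 'm) \<Rightarrow> 'm). (\<lambda>f. scaleM c (v f))"
  interpret W: vector_space ?sW
    by (rule M.vector_space_scale_fun)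
  interpret WW: vector_space_pair ?sW ?sW ..
  define ev where "ev xs = (\<lambda>f :: 'g list \<Rightarrow> 'm. if f \<in> ?A then f xs else 0)" for xs
  define bd where "bd v = (\<lambda>f. if f \<in> ?A then v (d f) else (0 :: 'm))" for v
  define V where "V = W.span (range ev)"
  have bd: "Vector_Spaces.linear ?sW ?sW bd"
  proof -
    have "bd (v + w) = bd v + bd w" for v w
      by (rule ext) (simp add: bd_def)
    moreover have "bd (?sW c v) = ?sW c (bd v)" for c v
      by (rule ext) (simp add: bd_def)
    ultimately show ?thesis
      unfolding Vector_Spaces.linear_iff using W.vector_space_axioms by blast
  qed
  obtain \<rho> where \<rho>: "range \<rho> \<subseteq> V" "Vector_Spaces.linear ?sW ?sW \<rho>" "\<And>v. v \<in> bd ` V \<Longrightarrow> bd (\<rho> v) = v"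
    using WW.linear_exists_right_inverse_on[OF bd W.subspace_span[of "range ev"]] unfolding V_def by blast
  have \<rho>_add: "\<rho> (v + w) = \<rho> v + \<rho> w" and \<rho>_scale: "\<rho> (?sW c v) = ?sW c (\<rho> v)" for v w c
    using \<rho>(2) unfolding Vector_Spaces.linear_iff by blast+
  have \<rho>_V: "\<rho> v \<in> V" for v
    using \<rho>(1) by blast
  have ev_V: "ev xs \<in> V" for xs
    unfolding V_def by (rule W.span_base) simp
  \<comment> \<open>Evaluations form a universal alternating map, so their differential is the boundary operator.\<close>
  have ce_ev: "ce_differential (\<lambda>_ _. 0) bracket ev xs = bd (ev xs)" for xs
  proof
    fix f
    have "ce_differential (\<lambda>_ _. 0) bracket ev xs f = d (\<lambda>zs. ev zs f) xs"
      by (rule ce_differential_comp[where \<mu> = "\<lambda>v. v f", symmetric]) (auto intro: additive.intro)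
    then show "ce_differential (\<lambda>_ _. 0) bracket ev xs f = bd (ev xs) f"
      by (simp add: bd_def ev_def ce_differential_zero ce_differential_alternating)
  qed
  have V_add: "v (\<lambda>xs. f xs + g xs) = v f + v g" if "v \<in> V" "f \<in> ?A" "g \<in> ?A" for v f g
  proof -
    have "v \<in> W.span (range ev)" using that V_def by simp
    then show ?thesis
      by (induction rule: W.span_induct)
        (auto simp: ev_def that alternating_plus W.subspace_def M.scale_right_distrib algebra_simps)
  qed
  have V_comp: "v (\<lambda>xs. \<alpha> (f xs)) = \<alpha> (v f)"
    if "v \<in> V" "f \<in> ?A" and \<alpha>: "Vector_Spaces.linear scaleM scaleM \<alpha>" for v f \<alpha>
  proof -
    interpret a: Vector_Spaces.linear scaleM scaleM \<alpha> by fact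
    have "v \<in> W.span (range ev)" using that V_def by simp
    then show ?thesis
      by (induction rule: W.span_induct)
        (auto simp: ev_def that alternating_comp W.subspace_def a.add a.scale a.zero)
  qed
  define P where "P f xs = \<rho> (ev xs) f" for f xs
  show ?thesis
  proof (rule that[of P])
    have add: "ev (xs @ (x + y) # ys) = ev (xs @ x # ys) + ev (xs @ y # ys)" for xs x y ys
      by (auto simp: ev_def fun_eq_iff alternating_add)
    have scale: "ev (xs @ scale c x # ys) = ?sW c (ev (xs @ x # ys))" for xs c x ys
      by (auto simp: ev_def fun_eq_iff alternating_scale)
    have adjacent: "ev (xs @ x # x # ys) = 0" for xs x ys
      by (auto simp: ev_def fun_eq_iff alternating_not_distinct)
    have "\<rho> 0 = 0"
      using \<rho>_add[of 0 0] by simp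
    then show "P f \<in> ?A" for f
      by (intro alternatingI) (auto simp: P_def add scale adjacent \<rho>_add \<rho>_scale)
    show "P (\<lambda>xs. f xs + g xs) = (\<lambda>xs. P f xs + P g xs)" if "f \<in> ?A" "g \<in> ?A" for f g
      using V_add[OF \<rho>_V that] by (simp add: P_def fun_eq_iff)
    show "P (\<lambda>xs. \<alpha> (f xs)) = (\<lambda>xs. \<alpha> (P f xs))"
      if "Vector_Spaces.linear scaleM scaleM \<alpha>" "f \<in> ?A" for \<alpha> f
      using V_comp[OF \<rho>_V that(2,1)] by (simp add: P_def fun_eq_iff)
    show "d (P (d f)) = d f" if f: "f \<in> ?A" for f
    proof
      fix xs
      have "d (P (d f)) xs = \<rho> (ce_differential (\<lambda>_ _. 0) bracket ev xs) (d f)"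
        unfolding P_def[abs_def]
        by (rule ce_differential_comp[where \<mu> = "\<lambda>v. \<rho> v (d f)" and f = ev])
          (auto intro: additive.intro simp: \<rho>_add \<open>\<rho> 0 = 0\<close>)
      also have "\<dots> = bd (\<rho> (bd (ev xs))) f"
        unfolding ce_ev bd_def[of "\<rho> _"] using f by simp
      also have "\<dots> = bd (ev xs) f"
        using \<rho>(3) ev_V by auto
      also have "\<dots> = d f xs"
        using f ce_differential_alternating[OF f] by (simp add: bd_def ev_def)
      finally show "d (P (d f)) xs = d f xs" .
    qed
  qed
qed

end

section \<open>The double complex of a semi-direct product\<close>

text \<open>
  The alternating map on a direct sum that belongs to a bicochain \<open>c\<close>: each argument is split
  into its two components, and these are moved to the places where \<open>c\<close> expects them. The middle list holds
  the arguments that are still to be distributed. An \<open>\<nn>\<close>-component jumps over the rest of this list, hence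
  the sign.
\<close>

fun shuffle :: "('h list \<Rightarrow> 'n list \<Rightarrow> 'm::ab_group_add) \<Rightarrow> 'h list \<Rightarrow> ('n \<times> 'h) list \<Rightarrow> 'n list \<Rightarrow> 'm" where
  "shuffle c xs [] as = c xs as"
| "shuffle c xs (z # zs) as =
    shuffle c (xs @ [snd z]) zs as + signed (length zs) (shuffle c xs zs (fst z # as))"

locale rank_one_action =
  lie_derivation_action scaleN bracketN scaleH bracketH \<phi> + HM: lie_module scaleH bracketH scaleM act
  for scaleN :: "'k::field \<Rightarrow> 'n::ab_group_add \<Rightarrow> 'n"
    and bracketN :: "'n \<Rightarrow> 'n \<Rightarrow> 'n"
    and scaleH :: "'k \<Rightarrow> 'h::ab_group_add \<Rightarrow> 'h"
    and bracketH :: "'h \<Rightarrow> 'h \<Rightarrow> 'h"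
    and \<phi> :: "'h \<Rightarrow> 'n \<Rightarrow> 'n"
    and scaleM :: "'k \<Rightarrow> 'm::ab_group_add \<Rightarrow> 'm"
    and act :: "'h \<Rightarrow> 'm \<Rightarrow> 'm" +
  fixes lam :: "'h \<Rightarrow> 'k" and D :: "'n \<Rightarrow> 'n"
  assumes D: "D \<in> N.Der"
    and phi: "\<phi> x a = scaleN (lam x) (D a)"
    and lam: "lam (x + y) = lam x + lam y" "lam (scaleH c x) = c * lam x" "lam (bracketH x y) = 0"
begin

abbreviation scaleG where "scaleG \<equiv> semidirect_scale scaleN scaleH"
abbreviation bracketG where "bracketG \<equiv> semidirect_bracket bracketN bracketH \<phi>"

sublocale G: hochschild_serre scaleG bracketG scaleM "inflate act" semidirect_ideal
  by (rule hochschild_serre_semidirect) (rule HM.lie_module_axioms)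

sublocale NM: trivial_coefficients scaleN bracketN scaleM ..

text \<open>
  The bidegree components of a cochain on the semi-direct product, all at once: \<open>restrict F xs\<close> is the value
  of an \<open>\<hh>\<close>-cochain with coefficients in the cochains of \<open>\<nn>\<close>. The filtration degree is the length of \<open>xs\<close>.
\<close>

definition restrict :: "(('n \<times> 'h) list \<Rightarrow> 'm) \<Rightarrow> 'h list \<Rightarrow> 'n list \<Rightarrow> 'm"
  where "restrict F xs as = F (map (Pair 0) xs @ map (\<lambda>a. (a, 0)) as)"

definition \<Theta> :: "('n list \<Rightarrow> 'm) \<Rightarrow> 'n list \<Rightarrow> 'm"
  where "\<Theta> = lie_derivative (\<lambda>_. 0) D"

text \<open>
  On multilinear maps this is the Lie derivative along \<open>x\<close>, with \<open>\<phi> x\<close> written as \<open>lam x\<close> times \<open>D\<close>.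
\<close>

definition twisted_act :: "'h \<Rightarrow> ('n list \<Rightarrow> 'm) \<Rightarrow> 'n list \<Rightarrow> 'm"
  where "twisted_act x f = (\<lambda>as. act x (f as)) + (\<lambda>as. scaleM (lam x) (\<Theta> f as))"

definition bicochains :: "('h list \<Rightarrow> 'n list \<Rightarrow> 'm) set"
  where "bicochains = {c. (\<forall>as. (\<lambda>xs. c xs as) \<in> alternating_maps scaleH scaleM) \<and>
    (\<forall>xs. c xs \<in> alternating_maps scaleN scaleM)}"

abbreviation "altG \<equiv> alternating_maps scaleG scaleM"
abbreviation "ceG \<equiv> ce_differential (inflate act) bracketG"
abbreviation "ceH \<equiv> ce_differential twisted_act bracketH"

lemma phi_zero [simp]: "\<phi> x 0 = 0" "\<phi> 0 a = 0"
proof -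
  show "\<phi> x 0 = 0"
    using derivation[of x] unfolding N.Der_def Vector_Spaces.linear_iff by (metis (mono_tags, lifting) CollectD add_cancel_left_left)
  show "\<phi> 0 a = 0"
    using lam(2)[of 0 0] by (simp add: phi)
qed

lemma D_linear: "Vector_Spaces.linear scaleN scaleN D"
  using D by (simp add: N.Der_def)

lemma restrict_bicochain:
  assumes F: "F \<in> altG"
  shows "restrict F \<in> bicochains"
  unfolding bicochains_def mem_Collect_eq
proof (intro conjI allI)
  have 1: "(0 :: 'n, x + y) = (0, x) + (0, y)" "(0, scaleH c x) = scaleG c (0, x)" for x y :: 'h and c
    by (simp_all add: semidirect_scale_def)
  have 2: "(a + b, 0 :: 'h) = (a, 0) + (b, 0)" "(scaleN c a, 0) = scaleG c (a, 0)" for a b :: 'n and c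
    by (simp_all add: semidirect_scale_def)
  show "(\<lambda>xs. restrict F xs as) \<in> alternating_maps scaleH scaleM" for as
  proof (rule HM.alternatingI)
    show "restrict F (xs @ (x + y) # ys) as = restrict F (xs @ x # ys) as + restrict F (xs @ y # ys) as"
      for xs x y ys
      by (simp only: restrict_def map_append list.map append_assoc append_Cons 1 G.alternating_add[OF F])
    show "restrict F (xs @ scaleH c x # ys) as = scaleM c (restrict F (xs @ x # ys) as)" for xs c x ys
      by (simp only: restrict_def map_append list.map append_assoc append_Cons 1 G.alternating_scale[OF F])
    show "restrict F (xs @ x # x # ys) as = 0" for xs x ys
      by (simp add: restrict_def G.alternating_not_distinct[OF F])
  qed
  show "restrict F xs \<in> alternating_maps scaleN scaleM" for xs
  proof (rule NM.alternatingI)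
    show "restrict F xs (as @ (a + b) # bs) = restrict F xs (as @ a # bs) + restrict F xs (as @ b # bs)"
      for as a b bs
      using G.alternating_add[OF F, of "map (Pair 0) xs @ map (\<lambda>a. (a, 0)) as" "(a, 0)" "(b, 0)"]
      by (simp add: restrict_def)
    show "restrict F xs (as @ scaleN c a # bs) = scaleM c (restrict F xs (as @ a # bs))" for as c a bs
      using G.alternating_scale[OF F, of "map (Pair 0) xs @ map (\<lambda>a. (a, 0)) as" c "(a, 0)"]
      by (simp add: restrict_def semidirect_scale_def)
    show "restrict F xs (as @ a # a # bs) = 0" for as a bs
      by (simp add: restrict_def G.alternating_not_distinct[OF F])
  qed
qed

text \<open>
  Every argument is the sum of its components, so \<open>F zs\<close> is a signed sum of values of \<open>restrict F\<close>. The
  \<open>\<hh>\<close>-component of an argument from the ideal is zero, so only those values remain that have at least as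
  many arguments in \<open>\<nn>\<close> as \<open>zs\<close> has in the ideal.
\<close>

lemma restrict_eq_0:
  assumes F: "F \<in> altG"
    and zero: "\<And>xs as. length xs + length as = n \<Longrightarrow> m \<le> int (length as) \<Longrightarrow> restrict F xs as = 0"
    and "length zs = n" "m \<le> int (length (filter (\<lambda>z. z \<in> semidirect_ideal) zs))"
  shows "F zs = 0"
proof -
  have "F (map (Pair 0) xs @ zs @ map (\<lambda>a. (a, 0)) as) = 0"
    if "length xs + length zs + length as = n"
      "m \<le> int (length (filter (\<lambda>z. z \<in> semidirect_ideal) zs)) + int (length as)" for xs as
    using that
  proof (induction zs arbitrary: xs as)
    case Nil
    then show ?case using zero[of xs as] by (simp add: restrict_def)
  next
    case (Cons z zs)
    let ?h = "map (Pair 0) xs :: ('n \<times> 'h) list" and ?n = "map (\<lambda>a. (a, 0)) as :: ('n \<times> 'h) list"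
    have z: "z = (0, snd z) + (fst z, 0)" by simp
    have "F (?h @ z # zs @ ?n) = F (?h @ (0, snd z) # zs @ ?n) + F (?h @ (fst z, 0) # zs @ ?n)"
      by (subst z) (rule G.alternating_add[OF F])
    moreover have "F (?h @ (0, snd z) # zs @ ?n) = 0"
    proof (cases "snd z = 0")
      case True
      then show ?thesis using G.alternating_zero_arg[OF F, of ?h] by (simp add: zero_prod_def)
    next
      case False
      then show ?thesis
        using Cons.IH[of "xs @ [snd z]" as] Cons.prems by (simp add: semidirect_ideal_def mem_Times_iff)
    qed
    moreover have "F (?h @ (fst z, 0) # zs @ ?n) = 0"
      using Cons.IH[of xs "fst z # as"] Cons.prems G.alternating_move[OF F, of ?h "(fst z, 0)" zs ?n]
      by (auto split: if_splits)
    ultimately show ?case by simp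
  qed
  from this[of "[]" "[]"] assms(3,4) show ?thesis by simp
qed

lemma restrict_inject:
  assumes "F \<in> altG" "\<And>xs as. restrict F xs as = 0"
  shows "F zs = 0"
  by (rule restrict_eq_0[OF assms(1), of "length zs" 0]) (simp_all add: assms(2))

lemma filtration_iff_restrict:
  "F \<in> G.filtration p n \<longleftrightarrow>
    F \<in> G.cochains n \<and> (\<forall>xs as. int (length xs) < p \<longrightarrow> restrict F xs as = 0)"
proof
  assume F: "F \<in> G.filtration p n"
  then have *: "F \<in> G.cochains n"
    by (simp add: G.filtration_def)
  moreover have "restrict F xs as = 0" if "int (length xs) < p" for xs as
  proof (cases "int (length xs + length as) = n")
    case False
    then show ?thesis using * by (simp add: restrict_def G.cochains_iff)
  next
    case True
    let ?zs = "map (Pair 0) xs @ map (\<lambda>a. (a, 0)) as :: ('n \<times> 'h) list"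
    have "filter (\<lambda>z. z \<in> semidirect_ideal) (map (\<lambda>a. (a, 0)) as) = (map (\<lambda>a. (a, 0)) as :: ('n \<times> 'h) list)"
      by (simp add: semidirect_ideal_def)
    then have "length as \<le> length (filter (\<lambda>z. z \<in> semidirect_ideal) ?zs)"
      by (simp only: filter_append length_append length_map)
    also have "\<dots> = card {i. i < length ?zs \<and> ?zs ! i \<in> semidirect_ideal}"
      by (rule length_filter_conv_card)
    finally have "n - p + 1 \<le> int (card {i. i < length ?zs \<and> ?zs ! i \<in> semidirect_ideal})"
      using True that by linarith
    then have "F ?zs = 0"
      using F unfolding G.filtration_def by blast
    then show ?thesis by (simp add: restrict_def)
  qed
  ultimately show "F \<in> G.cochains n \<and> (\<forall>xs as. int (length xs) < p \<longrightarrow> restrict F xs as = 0)"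
    by blast
next
  assume F: "F \<in> G.cochains n \<and> (\<forall>xs as. int (length xs) < p \<longrightarrow> restrict F xs as = 0)"
  have "F zs = 0" if "n - p + 1 \<le> int (card {i. i < length zs \<and> zs ! i \<in> semidirect_ideal})" for zs
  proof (cases "int (length zs) = n")
    case True
    show ?thesis
      by (rule restrict_eq_0[of F "length zs" "n - p + 1"])
        (use F True that in \<open>auto simp: G.cochains_iff length_filter_conv_card\<close>)
  next
    case False
    then show ?thesis using F by (simp add: G.cochains_iff)
  qed
  then show "F \<in> G.filtration p n"
    using F by (simp add: G.filtration_def)
qed

lemma restrict_lie_derivative:
  assumes "F \<in> altG"
  shows "lie_derivative (inflate act (0, x)) (bracketG (0, x)) F (map (Pair 0) xs @ map (\<lambda>a. (a, 0)) as) =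
    lie_derivative (twisted_act x) (bracketH x) (restrict F) xs as"
  using assms
proof (induction xs arbitrary: F)
  case Nil
  have "lie_derivative (inflate act (0, x)) (bracketG (0, x)) F (map (\<lambda>a. (a, 0)) as) =
      act x (F (map (\<lambda>a. (a, 0)) as)) +
      scaleM (lam x) (lie_derivative (\<lambda>_. 0) D (\<lambda>as. F (map (\<lambda>a. (a, 0)) as)) as)"
    using Nil
  proof (induction as arbitrary: F)
    case Nil
    then show ?case by (simp add: inflate_def)
  next
    case (Cons a as)
    have "bracketG (0, x) (a, 0) = scaleG (lam x) (D a, 0)"
      by (simp add: semidirect_bracket_def semidirect_scale_def NM.bracket_0 HM.bracket_0 flip: phi)
    then show ?case
      using Cons.IH[OF G.alternating_contract[OF Cons.prems, of "(a, 0)"]]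
        G.alternating_scale[OF Cons.prems, of "[]" "lam x" "(D a, 0)"]
      by (simp add: HM.M.scale_right_diff_distrib)
  qed
  then show ?case
    by (simp add: twisted_act_def \<Theta>_def restrict_def[abs_def])
next
  case (Cons y ys)
  have "bracketG (0, x) (0, y) = (0, bracketH x y)"
    by (simp add: semidirect_bracket_def NM.bracket_0)
  then show ?case
    using Cons.IH[OF G.alternating_contract[OF Cons.prems, of "(0, y)"]]
    by (simp add: restrict_def[abs_def])
qed

text \<open>
  The subspaces \<open>\<hh>\<close> and \<open>\<nn>\<close> are both subalgebras, and bracketing with elements of \<open>\<hh>\<close> preserves either.
  So the differential has only the two components of a double complex. The sign comes from
  moving the differential past the arguments in \<open>\<hh>\<close>.
\<close>

lemma restrict_ce_differential:
  assumes "F \<in> altG"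
  shows "restrict (ceG F) xs = ceH (restrict F) xs + signed (length xs) (NM.d (restrict F xs))"
proof
  fix as
  show "restrict (ceG F) xs as = (ceH (restrict F) xs + signed (length xs) (NM.d (restrict F xs))) as"
    using assms
  proof (induction xs arbitrary: F)
    case Nil
    have L: "lie_derivative (inflate act (a, 0)) (bracketG (a, 0)) F (map (\<lambda>a. (a, 0)) as) =
        lie_derivative (\<lambda>_. 0) (bracketN a) (\<lambda>as. F (map (\<lambda>a. (a, 0)) as)) as" for a as F
      by (induction as arbitrary: F)
        (simp_all add: inflate_def semidirect_bracket_def HM.act_0 HM.bracket_0)
    have "ceG F (map (\<lambda>a. (a, 0)) as) = NM.d (\<lambda>as. F (map (\<lambda>a. (a, 0)) as)) as"
      by (induction as arbitrary: F) (simp_all add: L)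
    then show ?case
      by (simp add: restrict_def[abs_def])
  next
    case (Cons x xs)
    have "(signed n f) as = signed n (f as)" for n and f :: "'n list \<Rightarrow> 'm"
      by (simp add: signed_def)
    then show ?case
      using Cons.IH[OF G.alternating_contract[OF Cons.prems, of "(0, x)"]]
        restrict_lie_derivative[OF Cons.prems, of x xs as]
      by (simp add: restrict_def[abs_def])
  qed
qed

lemma bicochainD:
  assumes "c \<in> bicochains"
  shows "(\<lambda>xs. c xs as) \<in> alternating_maps scaleH scaleM" "c xs \<in> alternating_maps scaleN scaleM"
  using assms by (auto simp: bicochains_def)

lemma shuffle_alternating:
  assumes c: "c \<in> bicochains"
  shows "(\<lambda>zs. shuffle c [] zs []) \<in> altG"
proof (rule G.alternatingI)
  note cH = bicochainD(1)[OF c] and cN = bicochainD(2)[OF c]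
  have H_add: "shuffle c (xs @ (x + y) # ys) zs as =
      shuffle c (xs @ x # ys) zs as + shuffle c (xs @ y # ys) zs as" for xs x y ys zs as
    by (induction zs arbitrary: ys as) (simp_all add: HM.alternating_add[OF cH] signed_add)
  have H_scale: "shuffle c (xs @ scaleH t x # ys) zs as = scaleM t (shuffle c (xs @ x # ys) zs as)"
    for xs t x ys zs as
    by (induction zs arbitrary: ys as)
      (simp_all add: HM.alternating_scale[OF cH] HM.M.scale_right_distrib signed_def)
  have N_add: "shuffle c xs zs (as @ (a + b) # bs) =
      shuffle c xs zs (as @ a # bs) + shuffle c xs zs (as @ b # bs)" for xs zs as a b bs
  proof (induction zs arbitrary: xs as)
    case (Cons z zs)
    show ?case using Cons[of _ "fst z # as"] Cons[of _ as] by (simp add: signed_add)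
  qed (simp add: NM.alternating_add[OF cN])
  have N_scale: "shuffle c xs zs (as @ scaleN t a # bs) = scaleM t (shuffle c xs zs (as @ a # bs))"
    for xs zs as t a bs
  proof (induction zs arbitrary: xs as)
    case (Cons z zs)
    show ?case using Cons[of _ "fst z # as"] Cons[of _ as]
      by (simp add: HM.M.scale_right_distrib signed_def)
  qed (simp add: NM.alternating_scale[OF cN])
  have H_repeat: "shuffle c xs zs as = 0" if "\<not> distinct xs" for xs zs as
    using that by (induction zs arbitrary: xs as) (auto simp: HM.alternating_not_distinct[OF cH])
  have N_repeat: "shuffle c xs zs as = 0" if "\<not> distinct as" for xs zs as
    using that by (induction zs arbitrary: xs as) (auto simp: NM.alternating_not_distinct[OF cN])
  have "shuffle c vs (ws @ (y + z) # zs) as = shuffle c vs (ws @ y # zs) as + shuffle c vs (ws @ z # zs) as"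
    for vs ws y z zs as
  proof (induction ws arbitrary: vs as)
    case Nil
    show ?case
      using H_add[of vs "snd y" "snd z" "[]"] N_add[of vs zs "[]" "fst y" "fst z"] by (simp add: signed_add)
  qed (simp add: signed_add)
  then show "shuffle c [] (ws @ (y + z) # zs) [] = shuffle c [] (ws @ y # zs) [] + shuffle c [] (ws @ z # zs) []"
    for ws y z zs .
  have "shuffle c vs (ws @ scaleG t z # zs) as = scaleM t (shuffle c vs (ws @ z # zs) as)"
    for vs ws t z zs as
  proof (induction ws arbitrary: vs as)
    case Nil
    show ?case
      using H_scale[of vs t "snd z" "[]"] N_scale[of vs zs "[]" t "fst z"]
      by (simp add: semidirect_scale_def HM.M.scale_right_distrib signed_def)
  qed (simp add: HM.M.scale_right_distrib signed_def)
  then show "shuffle c [] (ws @ scaleG t z # zs) [] = scaleM t (shuffle c [] (ws @ z # zs) [])" for ws t z zs .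
  have "shuffle c vs (ws @ z # z # zs) as = 0" for vs ws z zs as
    by (induction ws arbitrary: vs as) (simp_all add: H_repeat N_repeat signed_add)
  then show "shuffle c [] (ws @ z # z # zs) [] = 0" for ws z zs .
qed

lemma restrict_shuffle:
  assumes c: "c \<in> bicochains"
  shows "restrict (\<lambda>zs. shuffle c [] zs []) = c"
proof (intro ext)
  fix xs :: "'h list" and as :: "'n list"
  note cH = bicochainD(1)[OF c] and cN = bicochainD(2)[OF c]
  have H_zero: "shuffle c (ws @ 0 # ys) zs bs = 0" for ws ys zs bs
    by (induction zs arbitrary: ys bs) (simp_all add: HM.alternating_zero_arg[OF cH])
  have N_zero: "shuffle c ws zs (bs @ 0 # bs') = 0" for ws zs bs bs'
  proof (induction zs arbitrary: ws bs)
    case (Cons z zs)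
    show ?case using Cons[of _ "fst z # bs"] Cons[of _ bs] by simp
  qed (simp add: NM.alternating_zero_arg[OF cN])
  have N: "shuffle c ws (map (\<lambda>a. (a, 0)) as) bs = c ws (as @ bs)" for ws bs
  proof (induction as arbitrary: bs)
    case (Cons a as)
    show ?case
      using H_zero[of ws "[]"] Cons NM.alternating_move[OF bicochainD(2)[OF c, of ws], of "[]" a as bs] by simp
  qed simp
  have "shuffle c ws (map (Pair 0) xs @ map (\<lambda>a. (a, 0)) as) [] = c (ws @ xs) as" for ws
  proof (induction xs arbitrary: ws)
    case Nil
    show ?case using N[of ws "[]"] by simp
  next
    case (Cons x xs)
    show ?case
      using Cons[of "ws @ [x]"] N_zero[of ws _ "[]"] by simp
  qed
  from this[of "[]"] show "restrict (\<lambda>zs. shuffle c [] zs []) xs as = c xs as"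
    by (simp add: restrict_def)
qed

section \<open>Collapse for a one-dimensional action\<close>

lemma splitting_contraction:
  obtains P where "twisted_contraction (scale_fun scaleM) (alternating_maps scaleN scaleM)
    (\<lambda>x f as. act x (f as)) lam bracketH \<Theta> NM.d P"
proof -
  let ?A = "alternating_maps scaleN scaleM"
  obtain P :: "('n list \<Rightarrow> 'm) \<Rightarrow> 'n list \<Rightarrow> 'm" where
    P: "\<And>f. f \<in> ?A \<Longrightarrow> P f \<in> ?A"
    "\<And>f g. f \<in> ?A \<Longrightarrow> g \<in> ?A \<Longrightarrow> P (\<lambda>xs. f xs + g xs) = (\<lambda>xs. P f xs + P g xs)"
    "\<And>\<alpha> f. Vector_Spaces.linear scaleM scaleM \<alpha> \<Longrightarrow> f \<in> ?A \<Longrightarrow>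
      P (\<lambda>xs. \<alpha> (f xs)) = (\<lambda>xs. \<alpha> (P f xs))"
    "\<And>f. f \<in> ?A \<Longrightarrow> NM.d (P (NM.d f)) = NM.d f"
    using NM.natural_splitting by blast
  interpret L: vector_space "scale_fun scaleM :: 'k \<Rightarrow> ('n list \<Rightarrow> 'm) \<Rightarrow> 'n list \<Rightarrow> 'm"
    by (rule HM.M.vector_space_scale_fun)
  have act_add: "act x (m + m') = act x m + act x m'" and act_scale: "act x (scaleM t m) = scaleM t (act x m)"
    for x m m' t
    using HM.linear_act_right[of x] unfolding Vector_Spaces.linear_iff by blast+
  have linear_scaleM: "Vector_Spaces.linear scaleM scaleM (scaleM t)" for t
    unfolding Vector_Spaces.linear_iff
    by (simp add: HM.M.vector_space_axioms HM.M.scale_right_distrib mult.commute)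
  have additive: "additive (scaleM t)" for t
    by unfold_locales (rule HM.M.scale_right_distrib)
  have zero: "Vector_Spaces.linear scaleM scaleM (\<lambda>_. 0)"
    unfolding Vector_Spaces.linear_iff by (simp add: HM.M.vector_space_axioms)
  have additive0: "additive (\<lambda>_ :: 'm. 0 :: 'm)"
    by unfold_locales simp
  have D_bracket: "D (bracketN y z) = bracketN (D y) z + bracketN y (D z)" for y z
    using D by (simp add: N.Der_def)
  show ?thesis
  proof (rule that, unfold_locales)
    show "L.subspace ?A"
      unfolding L.subspace_def
      using NM.alternating_zero NM.alternating_plus NM.alternating_comp[OF _ linear_scaleM]
      by (auto simp: zero_fun_def plus_fun_def)
    fix a b :: "'n list \<Rightarrow> 'm" and x y t
    show "(\<lambda>as. act x (a as)) \<in> ?A" if "a \<in> ?A"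
      by (rule NM.alternating_comp[OF that HM.linear_act_right])
    show "(\<lambda>as. act x ((a + b) as)) = (\<lambda>as. act x (a as)) + (\<lambda>as. act x (b as))"
      "(\<lambda>as. act x (scaleM t (a as))) = (\<lambda>as. scaleM t (act x (a as)))"
      by (simp_all add: act_add act_scale fun_eq_iff)
    show "\<Theta> a \<in> ?A" if "a \<in> ?A"
      unfolding \<Theta>_def by (rule NM.lie_derivative_alternating[OF zero D_linear that])
    show "\<Theta> (a + b) = \<Theta> a + \<Theta> b"
      unfolding \<Theta>_def plus_fun_def by (rule ext) (rule lie_derivative_add[OF additive0])
    show "\<Theta> (\<lambda>as. scaleM t (a as)) = (\<lambda>as. scaleM t (\<Theta> a as))"
      unfolding \<Theta>_def
      by (rule ext) (rule lie_derivative_comp[where \<mu> = "scaleM t"], simp_all add: additive)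
    show "\<Theta> (\<lambda>as. act x (a as)) = (\<lambda>as. act x (\<Theta> a as))"
      unfolding \<Theta>_def
      by (rule ext)
        (rule lie_derivative_comp[where \<mu> = "act x"], simp_all add: HM.additive_act HM.act_0)
    show "NM.d a \<in> ?A" if "a \<in> ?A"
      by (rule NM.ce_differential_alternating[OF that])
    show "NM.d (a + b) = NM.d a + NM.d b"
      unfolding plus_fun_def by (rule ext) (rule ce_differential_add[OF additive0])
    show "NM.d (\<lambda>as. scaleM t (a as)) = (\<lambda>as. scaleM t (NM.d a as))"
      by (rule ext) (rule ce_differential_comp[where \<mu> = "scaleM t"], simp_all add: additive)
    show "NM.d (\<lambda>as. act x (a as)) = (\<lambda>as. act x (NM.d a as))"
      by (rule ext)
        (rule ce_differential_comp[where \<mu> = "act x"], simp_all add: HM.additive_act HM.act_0)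
    show "P a \<in> ?A" if "a \<in> ?A"
      by (rule P(1)[OF that])
    show "P (a + b) = P a + P b" if "a \<in> ?A" "b \<in> ?A"
      using P(2)[OF that] by (simp add: plus_fun_def)
    show "P (\<lambda>as. scaleM t (a as)) = (\<lambda>as. scaleM t (P a as))" if "a \<in> ?A"
      by (rule P(3)[OF linear_scaleM that])
    show "P (\<lambda>as. act x (a as)) = (\<lambda>as. act x (P a as))" if "a \<in> ?A"
      by (rule P(3)[OF HM.linear_act_right that])
    show "lam (bracketH x y) = 0"
      by (rule lam(3))
    show "NM.d (NM.d a) = 0" if "a \<in> ?A"
      by (rule ext) (simp add: NM.ce_differential_squared[OF that])
    show "\<Theta> (NM.d a) = NM.d (\<Theta> a)" if "a \<in> ?A"
      unfolding \<Theta>_def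
      by (rule ext) (rule NM.ce_differential_lie_derivative[OF additive0 additive0 that],
          simp_all add: D_bracket)
    show "NM.d (P (NM.d a)) = NM.d a" if "a \<in> ?A"
      by (rule P(4)[OF that])
  qed
qed

lemma bicochain_plus: "b \<in> bicochains \<Longrightarrow> c \<in> bicochains \<Longrightarrow> (\<lambda>xs. b xs + c xs) \<in> bicochains"
  unfolding bicochains_def
  using HM.alternating_plus NM.alternating_plus by (auto simp: plus_fun_def)

lemma bicochain_signed:
  assumes "c \<in> bicochains"
  shows "(\<lambda>xs. signed m (c xs)) \<in> bicochains"
proof -
  have "signed m f = (\<lambda>as. signed m (f as))" for f :: "'n list \<Rightarrow> 'm"
    by (simp add: signed_def fun_eq_iff)
  then show ?thesis
    using HM.alternating_signed[OF bicochainD(1)[OF assms]] NM.alternating_signed[OF bicochainD(2)[OF assms]]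
    by (simp add: bicochains_def)
qed

lemma bicochain_truncate:
  assumes "c \<in> bicochains"
  shows "(\<lambda>xs. if int (length xs) = p then c xs else 0) \<in> bicochains"
  using HM.alternating_truncate[OF bicochainD(1)[OF assms]] bicochainD(2)[OF assms] NM.alternating_zero
  by (auto simp: bicochains_def zero_fun_def if_distrib[of "\<lambda>f. f _"] cong: if_cong)

lemma bicochain_wedge:
  assumes "c \<in> bicochains" and "\<And>xs. wedge (scale_fun scaleM) lam c xs \<in> alternating_maps scaleN scaleM"
  shows "wedge (scale_fun scaleM) lam c \<in> bicochains"
proof -
  have "wedge (scale_fun scaleM) lam c xs as = wedge scaleM lam (\<lambda>ys. c ys as) xs" for xs as
    by (induction xs arbitrary: c) simp_all
  then show ?thesis
    using assms HM.wedge_alternating[OF lam(1,2) bicochainD(1)[OF assms(1)]]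
    by (simp add: bicochains_def)
qed

text \<open>
  Let \<open>cp\<close> be the component of \<open>f\<close> of lowest filtration degree \<open>p\<close>. The vanishing of \<open>df\<close> in degrees \<open>p\<close> and
  \<open>p + 1\<close> says that \<open>cp\<close> is a cocycle with values in the cohomology of \<open>\<nn>\<close>, which extends to a cocycle
  \<open>F\<close> with lowest component \<open>S cp\<close>. Then \<open>cp - S cp = d P cp\<close> is the lowest component of a coboundary
  \<open>dU\<close>, and \<open>g = f - F - dU\<close> has the same coboundary as \<open>f\<close> without any component in degree \<open>p\<close>.
\<close>

lemma exists_correction:
  assumes f: "f \<in> G.filtration p n" and df: "G.coboundary f \<in> G.filtration (p + 2) (n + 1)"
  shows "\<exists>g \<in> G.filtration (p + 1) n. G.coboundary g = G.coboundary f"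
proof -
  obtain P where "twisted_contraction (scale_fun scaleM) (alternating_maps scaleN scaleM)
      (\<lambda>x f as. act x (f as)) lam bracketH \<Theta> NM.d P"
    by (rule splitting_contraction)
  then interpret C: twisted_contraction "scale_fun scaleM" "alternating_maps scaleN scaleM"
      "\<lambda>x f as. act x (f as)" lam bracketH \<Theta> NM.d P .
  have vact: "C.vact = twisted_act"
    by (simp add: fun_eq_iff C.vact_def twisted_act_def)
  have bicochain_natural: "(\<lambda>xs. R (b xs)) \<in> bicochains" if R: "C.natural_operator R" and b: "b \<in> bicochains" for R b
  proof -
    note bH = bicochainD(1)[OF b]
    have add: "b (xs @ (x + y) # ys) = b (xs @ x # ys) + b (xs @ y # ys)"
      and scale: "b (xs @ scaleH t x # ys) = (\<lambda>as. scaleM t (b (xs @ x # ys) as))"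
      and repeat: "b (xs @ x # x # ys) = 0" for xs x y ys t
      by (simp_all add: fun_eq_iff HM.alternating_add[OF bH] HM.alternating_scale[OF bH]
          HM.alternating_not_distinct[OF bH])
    note RD = C.natural_operatorD[OF R]
    have "(\<lambda>xs. R (b xs) as) \<in> alternating_maps scaleH scaleM" for as
      by (rule HM.alternatingI)
        (simp_all add: add scale repeat RD bicochainD(2)[OF b])
    then show ?thesis
      using RD(1) bicochainD(2)[OF b] by (auto simp: bicochains_def)
  qed
  have f_alt: "f \<in> altG"
    using f by (auto simp: G.filtration_def G.cochains_iff)
  define c where "c = restrict f"
  define cp where "cp xs = (if int (length xs) = p then c xs else 0)" for xs
  have c: "c \<in> bicochains"
    unfolding c_def by (rule restrict_bicochain[OF f_alt])
  have cp: "cp \<in> bicochains"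
    unfolding cp_def[abs_def] by (rule bicochain_truncate[OF c])
  have cp_deg: "int (length xs) \<noteq> p \<Longrightarrow> cp xs = 0" for xs
    by (simp add: cp_def)
  note cpA = bicochainD(2)[OF cp]
  have c_low: "c xs = 0" if "int (length xs) < p" for xs
    using f that unfolding filtration_iff_restrict c_def by (auto simp: fun_eq_iff)
  have ce_zero: "ceH (\<lambda>_. 0) xs = 0" for xs
    using ce_differential_diff[OF C.additive_vact, where br = bracketH and f = "\<lambda>_. 0" and g = "\<lambda>_. 0" and xs = xs] by (simp add: vact)
  have ce_zeroI: "ceH b xs = 0" if "\<And>ys. Suc (length ys) = length xs \<Longrightarrow> b ys = 0" for b xs
    using ce_differential_cong[of xs b "\<lambda>_. 0" twisted_act bracketH] that by (simp add: ce_zero)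
  have d_zero: "NM.d 0 = 0"
    by (rule C.natural_operatorD(5)[OF C.natural_operators(2)])
  have signed_d: "NM.d (signed m a) = signed m (NM.d a)" for m a
    using C.d(3)[of "-1" a] by (auto simp: signed_def fun_Compl_def)
  have dc: "ceH c xs = - signed (length xs) (NM.d (c xs))" if "int (length xs) < p + 2" for xs
  proof -
    have ce: "G.coboundary f = ceG f"
      using G.coboundary_eq_ce_differential[OF f_alt] by auto
    have "restrict (ceG f) xs = 0"
      using df that unfolding filtration_iff_restrict ce by (auto simp: fun_eq_iff)
    then show ?thesis
      unfolding restrict_ce_differential[OF f_alt] c_def[symmetric] by (simp add: eq_neg_iff_add_eq_0)
  qed
  have vertical: "NM.d (cp xs) = 0" for xs
  proof (cases "int (length xs) = p")
    case True
    have "ceH c xs = 0"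
      by (rule ce_zeroI) (use True c_low in auto)
    then show ?thesis
      using dc[of xs] True by (simp add: cp_def)
  qed (simp add: cp_def d_zero)
  have horizontal: "\<exists>e\<in>alternating_maps scaleN scaleM. ceH cp xs = NM.d e" for xs
  proof (cases "int (length xs) = p + 1")
    case True
    have "ceH cp xs = ceH c xs"
      by (rule ce_differential_cong) (use True in \<open>simp add: cp_def\<close>)
    also have "\<dots> = - signed (length xs) (NM.d (c xs))"
      by (rule dc) (use True in simp)
    also have "\<dots> = NM.d (signed (Suc (length xs)) (c xs))"
      by (simp only: signed_d signed_simps(2)[symmetric])
    finally show ?thesis
      using bicochainD(2)[OF bicochain_signed[OF c]] by blast
  next
    case False
    have "ceH cp xs = 0"
      by (rule ce_zeroI) (use False in \<open>auto simp: cp_def\<close>)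
    then show ?thesis
      using d_zero C.A_closed(4) by metis
  qed
  define c' where "c' xs = C.S (cp xs) +
      signed (nat p) (wedge (scale_fun scaleM) lam (\<lambda>ys. C.T (cp ys)) xs)" for xs
  \<comment> \<open>The sign cancels the one in front of the vertical differential in \<open>dU\<close>.\<close>
  define u where "u xs = signed (nat p) (P (cp xs))" for xs
  have Tcp: "(\<lambda>xs. C.T (cp xs)) \<in> bicochains"
    by (rule bicochain_natural[OF C.natural_T cp])
  have c': "c' \<in> bicochains"
    unfolding c'_def[abs_def]
    by (rule bicochain_plus[OF bicochain_natural[OF C.natural_S cp]
          bicochain_signed[OF bicochain_wedge[OF Tcp C.wedge_closed[OF bicochainD(2)[OF Tcp]]]]])
  have u: "u \<in> bicochains"
    unfolding u_def[abs_def]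
    by (rule bicochain_signed[OF bicochain_natural[OF C.natural_operators(3) cp]])
  have closed_c': "ceH c' xs + signed (length xs) (NM.d (c' xs)) = 0" for xs
    unfolding c'_def[abs_def] vact[symmetric]
    by (rule C.corrected_cocycle[OF cpA cp_deg vertical horizontal[folded vact]])
  define F where "F zs = shuffle c' [] zs []" for zs
  define U where "U zs = shuffle u [] zs []" for zs
  have F: "F \<in> altG" "restrict F = c'" and U: "U \<in> altG" "restrict U = u"
    using shuffle_alternating restrict_shuffle c' u unfolding F_def[abs_def] U_def[abs_def] by auto
  have ceF: "ceG F zs = 0" for zs
    by (rule restrict_inject[OF G.ce_differential_alternating[OF F(1)]])
      (simp add: restrict_ce_differential[OF F(1)] F(2) closed_c')
  define g0 where "g0 zs = f zs - F zs - ceG U zs" for zs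
  \<comment> \<open>The operators \<open>P\<close> and \<open>T\<close> need not respect degrees. The differential is homogeneous, so the other degrees can be cut off.\<close>
  define g where "g zs = (if int (length zs) = n then g0 zs else 0)" for zs
  have g0: "g0 \<in> altG"
    unfolding g0_def[abs_def]
    by (intro G.alternating_minus G.ce_differential_alternating f_alt F U)
  have g: "g \<in> G.cochains n"
    using G.alternating_truncate[OF g0, of n] by (simp add: G.cochains_iff g_def[abs_def])
  have low: "restrict g0 xs = 0" if "int (length xs) < p + 1" for xs
  proof -
    have "restrict g0 xs = c xs - c' xs - (ceH u xs + signed (length xs) (NM.d (u xs)))"
      using restrict_ce_differential[OF U(1), of xs] F(2) U(2)
      by (auto simp: restrict_def g0_def c_def fun_eq_iff)
    also have "ceH u xs = 0"
      by (rule ce_zeroI)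
        (use that in \<open>auto simp: u_def cp_def C.natural_operatorD(5)[OF C.natural_operators(3)]\<close>)
    also have "wedge (scale_fun scaleM) lam (\<lambda>ys. C.T (cp ys)) xs = wedge (scale_fun scaleM) lam (\<lambda>ys. 0) xs"
      by (rule wedge_cong) (use that in \<open>auto simp: cp_def C.natural_operatorD(5)[OF C.natural_T]\<close>)
    then have "c' xs = C.S (cp xs)"
      by (simp add: c'_def C.wedge_zero)
    also have "c xs = cp xs"
      using that c_low[of xs] by (auto simp: cp_def)
    also have "signed (length xs) (NM.d (u xs)) = NM.d (P (cp xs))"
    proof (cases "int (length xs) = p")
      case True
      then have "length xs = nat p" by simp
      then show ?thesis by (simp add: u_def signed_d)
    next
      case False
      then show ?thesis
        by (simp add: u_def cp_def d_zero C.natural_operatorD(5)[OF C.natural_operators(3)])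
    qed
    finally show ?thesis by (simp add: C.S_def zero_fun_def)
  qed
  have "restrict g xs as = 0" if "int (length xs) < p + 1" for xs as
    using fun_cong[OF low[OF that], of as] by (simp add: restrict_def g_def)
  then have "g \<in> G.filtration (p + 1) n"
    unfolding filtration_iff_restrict using g by blast
  moreover have "G.coboundary g = G.coboundary f"
  proof
    fix zs :: "('n \<times> 'h) list"
    show "G.coboundary g zs = G.coboundary f zs"
    proof (cases "int (length zs) = n + 1")
      case True
      have "G.coboundary g zs = ceG g zs"
        using g by (intro G.coboundary_eq_ce_differential) (simp add: G.cochains_iff)
      also have "\<dots> = ceG g0 zs"
        by (rule ce_differential_cong) (use True in \<open>simp add: g_def\<close>)
      also have "\<dots> = ceG f zs"
        unfolding g0_def[abs_def]
        by (simp add: ce_differential_diff[OF G.additive_act] ceF G.ce_differential_squared[OF U(1)])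
      also have "\<dots> = G.coboundary f zs"
        by (rule G.coboundary_eq_ce_differential[OF f_alt, symmetric])
      finally show ?thesis .
    next
      case False
      moreover have "f \<in> G.cochains n"
        using f by (simp add: G.filtration_def)
      ultimately show ?thesis
        using G.coboundary_cochain g unfolding G.cochains_iff by metis
    qed
  qed
  ultimately show ?thesis by blast
qed

lemma collapses: "G.collapses_at_page 2"
  by (rule G.collapses_at_page_2I) (rule exists_correction)

end

text \<open>
  The linear form vanishes on brackets because any two multiples of \<open>D\<close> commute, while \<open>D \<noteq> 0\<close>.
\<close>

lemma (in lie_derivation_action) rank_one_factorization:
  assumes "vector_space.dim (scale_fun scaleN) (range \<phi>) = 1"
  obtains lam D where "D \<in> N.Der" "\<And>x a. \<phi> x a = scaleN (lam x) (D a)"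
    "\<And>x y. lam (x + y) = lam x + lam y" "\<And>c x. lam (scaleH c x) = c * lam x"
    "\<And>x y. lam (bracketH x y) = 0"
proof -
  interpret F: vector_space "scale_fun scaleN :: 'k \<Rightarrow> ('n \<Rightarrow> 'n) \<Rightarrow> 'n \<Rightarrow> 'n"
    by (rule N.vector_space_scale_fun)
  obtain B where B: "B \<subseteq> range \<phi>" "F.independent B" "range \<phi> \<subseteq> F.span B" "card B = F.dim (range \<phi>)"
    using F.basis_exists[of "range \<phi>"] by blast
  then obtain D where BD: "B = {D}"
    using assms by (metis card_1_singletonE)
  have "D \<noteq> 0"
    using B(2) F.dependent_zero BD by auto
  have "\<exists>c. \<phi> x = (\<lambda>a. scaleN c (D a))" for x
    using B(3) F.span_singleton[of D] unfolding BD by auto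
  then obtain lam where lam: "\<And>x. \<phi> x = (\<lambda>a. scaleN (lam x) (D a))"
    by metis
  obtain a0 where a0: "D a0 \<noteq> 0"
    using \<open>D \<noteq> 0\<close> by (auto simp: fun_eq_iff)
  have cancel: "c = c'" if "scaleN c (D a0) = scaleN c' (D a0)" for c c'
    using that a0 by simp
  show ?thesis
  proof (rule that[of D lam])
    show "D \<in> N.Der"
      using B(1) BD derivation by auto
    then have D_scale: "D (scaleN c a) = scaleN c (D a)" for c a
      by (simp add: N.Der_def Vector_Spaces.linear_iff)
    show "\<phi> x a = scaleN (lam x) (D a)" for x a
      by (simp add: lam)
    have phi_add: "\<phi> (x + y) = \<phi> x + \<phi> y" and phi_scale: "\<phi> (scaleH c x) = (\<lambda>a. scaleN c (\<phi> x a))" for x y c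
      using linear_hom unfolding Vector_Spaces.linear_iff by blast+
    show "lam (x + y) = lam x + lam y" for x y
      using fun_cong[OF phi_add[of x y], of a0] by (intro cancel) (simp add: lam N.scale_left_distrib)
    show "lam (scaleH c x) = c * lam x" for c x
      using fun_cong[OF phi_scale[of c x], of a0] by (intro cancel) (simp add: lam)
    show "lam (bracketH x y) = 0" for x y
      using fun_cong[OF hom_bracket[of x y], of a0] a0
      by (simp add: lam D_scale mult.commute)
  qed
qed

theorem corollary1p6:
  fixes scaleN :: "'k::field \<Rightarrow> 'n::ab_group_add \<Rightarrow> 'n"
    and bracketN :: "'n \<Rightarrow> 'n \<Rightarrow> 'n"
    and scaleH :: "'k \<Rightarrow> 'h::ab_group_add \<Rightarrow> 'h"
    and bracketH :: "'h \<Rightarrow> 'h \<Rightarrow> 'h"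
    and \<phi> :: "'h \<Rightarrow> 'n \<Rightarrow> 'n"
    and scaleM :: "'k \<Rightarrow> 'm::ab_group_add \<Rightarrow> 'm"
    and act :: "'h \<Rightarrow> 'm \<Rightarrow> 'm"
  assumes "lie_derivation_action scaleN bracketN scaleH bracketH \<phi>"
    and "vector_space.dim (scale_fun scaleN) (range \<phi>) = 1"
    and "lie_module scaleH bracketH scaleM act"
  shows "hochschild_serre.collapses_at_page
    (semidirect_scale scaleN scaleH) (semidirect_bracket bracketN bracketH \<phi>)
    scaleM (inflate act) semidirect_ideal 2"
proof -
  interpret lie_derivation_action scaleN bracketN scaleH bracketH \<phi> by fact
  interpret HM: lie_module scaleH bracketH scaleM act by fact
  show ?thesis
  proof (rule rank_one_factorization[OF assms(2)])
    fix lam D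
    assume "D \<in> N.Der" "\<And>x a. \<phi> x a = scaleN (lam x) (D a)"
      "\<And>x y. lam (x + y) = lam x + lam y" "\<And>c x. lam (scaleH c x) = c * lam x"
      "\<And>x y. lam (bracketH x y) = 0"
    then interpret rank_one_action scaleN bracketN scaleH bracketH \<phi> scaleM act lam D
      by (intro rank_one_action.intro rank_one_action_axioms.intro assms)
    show ?thesis by (rule collapses)
  qed
qed

end
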